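(* Let $(\mathcal{X},d)$ be a proper metric space, $\boldsymbol{\nu}=(\nu_1,\dots,\nu_N)\in\mathcal{P}_1(\mathcal{X})^N$, $\boldsymbol{\lambda}=(\lambda_1,\dots,\lambda_N)\in\Delta_N$ with each $\lambda_i>0$, and $\nu\in\mathcal{P}_1(\mathcal{X})$. Then $\nu\in\mathrm{Med}_{\boldsymbol{\lambda}}(\boldsymbol{\nu})$ if and only if there exist $\psi_1,\dots,\psi_N$ such that (1) for each $i$, $\psi_i\in\mathrm{Lip}_1(\mathcal{X})$ and $W_1(\nu_i,\nu)=\int_{\mathcal{X}}\psi_i\,d\nu_i-\int_{\mathcal{X}}\psi_i\,d\nu$; (2) $\sum_{i=1}^N\lambda_i\psi_i\le0$ on $\mathcal{X}$ and $\sum_{i=1}^N\lambda_i\psi_i=0$ on $\mathrm{spt}(\nu)$.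
   Context: A metric space is proper if its closed balls are compact. $\Delta_N$ is the unit simplex of $\mathbb{R}^N$; $\mathcal{P}_1(\mathcal{X})$ is the set of Borel probability measures with finite first moment, $W_1$ the 1-Wasserstein distance. $\mathrm{Med}_{\boldsymbol{\lambda}}(\boldsymbol{\nu})$ is the set of minimizers over $\mu\in\mathcal{P}_1(\mathcal{X})$ of $\sum_i\lambda_iW_1(\nu_i,\mu)$. $\mathrm{Lip}_1(\mathcal{X})$ is the set of 1-Lipschitz real functions on $\mathcal{X}$; $\mathrm{spt}(\nu)$ is the support of $\nu$. *)

theory Defs
  imports "HOL-Probability.Probability"
begin

definition proper_space :: "'a::metric_space itself \<Rightarrow> bool" where
  "proper_space _ \<longleftrightarrow> (\<forall>(x::'a) r. compact (cball x r))"

definition P1 :: "'a::metric_space measure \<Rightarrow> bool" where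
  "P1 M \<longleftrightarrow> prob_space M \<and> sets M = sets borel \<and>
     (\<exists>x0. integrable M (\<lambda>y. dist x0 y))"

definition couplings :: "'a::metric_space measure \<Rightarrow> 'a measure \<Rightarrow> ('a \<times> 'a) measure set" where
  "couplings M1 M2 = {\<pi>. prob_space \<pi> \<and> sets \<pi> = sets (borel \<Otimes>\<^sub>M borel) \<and>
       distr \<pi> borel fst = M1 \<and> distr \<pi> borel snd = M2}"

text \<open>1-Wasserstein distance (finite for measures in P1).\<close>
definition W1 :: "'a::metric_space measure \<Rightarrow> 'a measure \<Rightarrow> real" where
  "W1 M1 M2 = enn2real (\<Sqinter>\<pi>\<in>couplings M1 M2. \<integral>\<^sup>+ p. ennreal (dist (fst p) (snd p)) \<partial>\<pi>)"

definition Med :: "nat \<Rightarrow> (nat \<Rightarrow> real) \<Rightarrow> (nat \<Rightarrow> 'a::metric_space measure) \<Rightarrow> 'a measure set" where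
  "Med N lam nu = {\<mu>. P1 \<mu> \<and>
      (\<forall>\<mu>'. P1 \<mu>' \<longrightarrow> (\<Sum>i<N. lam i * W1 (nu i) \<mu>) \<le> (\<Sum>i<N. lam i * W1 (nu i) \<mu>'))}"

definition spt :: "'a::topological_space measure \<Rightarrow> 'a set" where
  "spt M = {x. \<forall>U. open U \<and> x \<in> U \<longrightarrow> emeasure M U > 0}"

end

theory Submission
  imports Defs
begin

text \<open>
  Sufficiency is weak duality: a coupling bounds the integral difference of a 1-Lipschitz function,
  and the support carries full measure. For necessity, Kantorovich-Rubinstein duality
  turns \<open>\<Sum>\<^sub>i \<lambda>\<^sub>i W\<^sub>1(\<nu>\<^sub>i, \<mu>')\<close> into the supremum over tuples of 1-Lipschitz functions of an
  expression that is affine in \<open>\<mu>'\<close>. Since \<open>\<mu>\<close> minimises it, the Hahn-Banach theorem yields a finitely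
  additive mean on the set of tuples under which the expression is at least the minimal value for
  every \<open>\<mu>'\<close>; the barycentre of that mean is a tuple of 1-Lipschitz functions \<open>\<psi>\<^sub>i\<close>. The choice
  \<open>\<mu>' = \<mu>\<close> gives optimality of each \<open>\<psi>\<^sub>i\<close>, Dirac masses give
  \<open>\<Sum>\<^sub>i \<lambda>\<^sub>i \<psi>\<^sub>i \<le> \<integral> \<Sum>\<^sub>i \<lambda>\<^sub>i \<psi>\<^sub>i d\<mu>\<close>, and subtracting the constant on the right finishes the proof.

  Duality itself comes from the same separation argument: Hahn-Banach produces a positive
  functional on functions of two variables that has the right marginals and does not exceed the
  dual value on the metric. Evaluated on the product cells of two fine finite partitions
  it is a finite transport plan, which is then realised as a density with respect to the product measure.
\<close>

section \<open>Linear functionals dominated by sublinear ones\<close>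


definition sublinear_on :: "('i \<Rightarrow> real) set \<Rightarrow> (('i \<Rightarrow> real) \<Rightarrow> real) \<Rightarrow> bool" where
  "sublinear_on V p \<longleftrightarrow>
     (\<forall>f\<in>V. \<forall>g\<in>V. p (\<lambda>z. f z + g z) \<le> p f + p g) \<and>
     (\<forall>f\<in>V. \<forall>c>0. p (\<lambda>z. c * f z) \<le> c * p f)"

definition fun_subspace :: "('i \<Rightarrow> real) set \<Rightarrow> bool" where
  "fun_subspace V \<longleftrightarrow> (\<lambda>z. 0) \<in> V \<and>
     (\<forall>f\<in>V. \<forall>g\<in>V. (\<lambda>z. f z + g z) \<in> V) \<and> (\<forall>f\<in>V. \<forall>c. (\<lambda>z. c * f z) \<in> V)"

definition linear_functional_on :: "('i \<Rightarrow> real) set \<Rightarrow> (('i \<Rightarrow> real) \<Rightarrow> real) \<Rightarrow> bool" where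
  "linear_functional_on V L \<longleftrightarrow>
     (\<forall>f\<in>V. \<forall>g\<in>V. L (\<lambda>z. f z + g z) = L f + L g) \<and>
     (\<forall>f\<in>V. \<forall>c. L (\<lambda>z. c * f z) = c * L f)"

lemma fun_subspaceD:
  assumes "fun_subspace V"
  shows "(\<lambda>z. 0) \<in> V" "f \<in> V \<Longrightarrow> g \<in> V \<Longrightarrow> (\<lambda>z. f z + g z) \<in> V" "f \<in> V \<Longrightarrow> (\<lambda>z. c * f z) \<in> V"
  using assms by (auto simp: fun_subspace_def)

lemma sublinear_onD:
  assumes "sublinear_on V p"
  shows "f \<in> V \<Longrightarrow> g \<in> V \<Longrightarrow> p (\<lambda>z. f z + g z) \<le> p f + p g"
    and "f \<in> V \<Longrightarrow> c > 0 \<Longrightarrow> p (\<lambda>z. c * f z) \<le> c * p f"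
  using assms by (auto simp: sublinear_on_def)

lemma linear_functional_onD:
  assumes "linear_functional_on V L"
  shows "f \<in> V \<Longrightarrow> g \<in> V \<Longrightarrow> L (\<lambda>z. f z + g z) = L f + L g" "f \<in> V \<Longrightarrow> L (\<lambda>z. c * f z) = c * L f"
  using assms by (auto simp: linear_functional_on_def)

lemma linear_functional_on_zero:
  assumes V: "fun_subspace V" and L: "linear_functional_on V L"
  shows "L (\<lambda>z. 0) = 0"
  using linear_functional_onD(2)[OF L fun_subspaceD(1)[OF V], where c = 0] by simp

lemma linear_functional_on_minus:
  assumes L: "linear_functional_on V L" and f: "f \<in> V"
  shows "L (\<lambda>z. - f z) = - L f"
  using linear_functional_onD(2)[OF L f, where c = "-1"] by simp

lemma linear_functional_on_diff:
  assumes V: "fun_subspace V" and L: "linear_functional_on V L" and f: "f \<in> V" and g: "g \<in> V"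
  shows "(\<lambda>z. f z - g z) \<in> V" "L (\<lambda>z. f z - g z) = L f - L g"
proof -
  have m: "(\<lambda>z. - g z) \<in> V" using fun_subspaceD(3)[OF V g, of "-1"] by simp
  show "(\<lambda>z. f z - g z) \<in> V" using fun_subspaceD(2)[OF V f m] by simp
  show "L (\<lambda>z. f z - g z) = L f - L g"
    using linear_functional_onD(1)[OF L f m] linear_functional_on_minus[OF L g] by simp
qed

lemma linear_functional_on_sum:
  assumes V: "fun_subspace V" and L: "linear_functional_on V L" and "finite I" and "\<And>i. i \<in> I \<Longrightarrow> F i \<in> V"
  shows "(\<lambda>z. \<Sum>i\<in>I. c i * F i z) \<in> V \<and> L (\<lambda>z. \<Sum>i\<in>I. c i * F i z) = (\<Sum>i\<in>I. c i * L (F i))"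
  using assms(3,4)
proof (induction I rule: finite_induct)
  case empty
  show ?case using linear_functional_on_zero[OF V L] fun_subspaceD(1)[OF V] by simp
next
  case (insert i I)
  have cF: "(\<lambda>z. c i * F i z) \<in> V" using insert by (intro fun_subspaceD(3)[OF V]) simp
  have IH: "(\<lambda>z. \<Sum>i\<in>I. c i * F i z) \<in> V" "L (\<lambda>z. \<Sum>i\<in>I. c i * F i z) = (\<Sum>i\<in>I. c i * L (F i))"
    using insert by auto
  show ?case
    using fun_subspaceD(2)[OF V cF IH(1)] linear_functional_onD(1)[OF L cF IH(1)]
      linear_functional_onD(2)[OF L, of "F i" "c i"] IH(2) insert by simp
qed

section \<open>The Hahn-Banach theorem through minimal sublinear functionals\<close>

lemma sublinear_on_zero:
  assumes V: "fun_subspace V" and p: "sublinear_on V p"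
  shows "p (\<lambda>z. 0) = 0"
  \<comment> \<open>The factor 2 shows that the value at the zero function is nonnegative, the
    factor 1/2 that it is nonpositive.\<close>
  using sublinear_onD(2)[OF p fun_subspaceD(1)[OF V], of 2]
    sublinear_onD(2)[OF p fun_subspaceD(1)[OF V], of "1/2"] by simp

text \<open>Homogeneity is demanded as an inequality only, which infima inherit easily. Rescaling
  \<open>c * f\<close> by \<open>1/c\<close> gives the reverse inequality.\<close>

lemma sublinear_on_scale:
  assumes V: "fun_subspace V" and p: "sublinear_on V p" and f: "f \<in> V" and c: "c > 0"
  shows "p (\<lambda>z. c * f z) = c * p f"
proof (rule antisym)
  have "p f \<le> (1/c) * p (\<lambda>z. c * f z)"
    using sublinear_onD(2)[OF p fun_subspaceD(3)[OF V f, of c], of "1/c"] c by simp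
  then show "c * p f \<le> p (\<lambda>z. c * f z)" using c by (simp add: field_simps)
qed (use sublinear_onD(2)[OF p f c] in simp)

lemma sublinear_on_lower:
  assumes V: "fun_subspace V" and p: "sublinear_on V p" and f: "f \<in> V"
  shows "- p (\<lambda>z. - f z) \<le> p f"
  using sublinear_onD(1)[OF p f fun_subspaceD(3)[OF V f, of "-1"]] sublinear_on_zero[OF V p] by simp

text \<open>A minimal sublinear functional below \<open>p\<close> is automatically linear, so no extension from
  subspaces is needed.\<close>
lemma minimal_sublinear_exists:
  fixes V :: "('i \<Rightarrow> real) set"
  assumes V: "fun_subspace V" and p: "sublinear_on V p"
  shows "\<exists>m. sublinear_on V m \<and> (\<forall>f\<in>V. m f \<le> p f) \<and>
    (\<forall>q. sublinear_on V q \<longrightarrow> (\<forall>f\<in>V. q f \<le> m f) \<longrightarrow> (\<forall>f\<in>V. q f = m f))"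
proof -
  \<comment> \<open>With the values off \<open>V\<close> pinned to 0, the pointwise order on
    \<open>S\<close> depends on the values on \<open>V\<close> alone.\<close>
  define S where "S = {q. sublinear_on V q \<and> (\<forall>f\<in>V. q f \<le> p f) \<and> (\<forall>f. f \<notin> V \<longrightarrow> q f = 0)}"
  \<comment> \<open>The order is reversed, so that the maximal element supplied by Zorn's lemma is a
    minimal functional.\<close>
  define P :: "(('i \<Rightarrow> real) \<Rightarrow> real) \<Rightarrow> (('i \<Rightarrow> real) \<Rightarrow> real) \<Rightarrow> bool" where "P q q' \<longleftrightarrow> q' \<le> q" for q q'
  have restrict: "sublinear_on V (\<lambda>f. if f \<in> V then q f else 0) \<longleftrightarrow> sublinear_on V q" for q
    unfolding sublinear_on_def by (auto simp: fun_subspaceD[OF V])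
  have "\<exists>m\<in>S. \<forall>a\<in>S. P m a \<longrightarrow> a = m"
  proof (rule predicate_Zorn)
    show "partial_order_on S (relation_of P S)"
      by (rule partial_order_on_relation_ofI) (auto simp: P_def)
  next
    fix C assume C: "C \<in> Chains (relation_of P S)"
    then have CS: "C \<subseteq> S" and tot: "\<And>q q'. q \<in> C \<Longrightarrow> q' \<in> C \<Longrightarrow> q \<le> q' \<or> q' \<le> q"
      by (auto simp: Chains_def relation_of_def P_def)
    show "\<exists>u\<in>S. \<forall>a\<in>C. P a u"
    proof (cases "C = {}")
      case True
      have "(\<lambda>f. if f \<in> V then p f else 0) \<in> S" using p by (simp add: S_def restrict)
      then show ?thesis using True by blast
    next
      case False
      define u where "u f = (INF q\<in>C. q f)" for f
      \<comment> \<open>The bound is uniform over the chain: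
        \<open>- p (- f) \<le> - q (- f) \<le> q f\<close> for each of its members
        \<open>q\<close>.\<close>
      have bdd: "bdd_below ((\<lambda>q. q f) ` C)" if "f \<in> V" for f
      proof (rule bdd_belowI2)
        fix q assume "q \<in> C"
        then have q: "sublinear_on V q" "\<forall>f\<in>V. q f \<le> p f" using CS by (auto simp: S_def)
        show "- p (\<lambda>z. - f z) \<le> q f"
          using sublinear_on_lower[OF V q(1) that] q(2)[rule_format, OF fun_subspaceD(3)[OF V that, of "-1"]]
          by simp
      qed
      have le: "u f \<le> q f" if "f \<in> V" "q \<in> C" for f q
        unfolding u_def using bdd that by (intro cINF_lower) auto
      have sub: "sublinear_on V u"
        unfolding sublinear_on_def
      proof (intro conjI ballI allI impI)
        fix f g assume fg: "f \<in> V" "g \<in> V"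
        \<comment> \<open>In a chain the smaller of \<open>q1\<close> and \<open>q2\<close> serves
          both summands; this makes the infimum subadditive.\<close>
        have *: "u (\<lambda>z. f z + g z) \<le> q1 f + q2 g" if q: "q1 \<in> C" "q2 \<in> C" for q1 q2
        proof -
          obtain q where "q \<in> C" "q \<le> q1" "q \<le> q2" using tot[OF q] q by auto
          moreover have "q (\<lambda>z. f z + g z) \<le> q f + q g"
            using CS \<open>q \<in> C\<close> fg by (auto simp: S_def sublinear_on_def)
          ultimately show ?thesis
            using le[OF fun_subspaceD(2)[OF V fg] \<open>q \<in> C\<close>] by (force simp: le_fun_def dest: spec[of _ f] spec[of _ g] intro: order_trans[OF _ add_mono])
        qed
        have "u (\<lambda>z. f z + g z) - q1 f \<le> u g" if "q1 \<in> C" for q1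
          unfolding u_def[of g] using False *[OF that] by (intro cINF_greatest) (auto simp: algebra_simps)
        then have "u (\<lambda>z. f z + g z) - u g \<le> u f"
          unfolding u_def[of f] using False by (intro cINF_greatest) (auto simp: algebra_simps)
        then show "u (\<lambda>z. f z + g z) \<le> u f + u g" by simp
      next
        fix f and c :: real assume f: "f \<in> V" and c: "c > 0"
        have "u (\<lambda>z. c * f z) / c \<le> u f"
          unfolding u_def[of f]
        proof (rule cINF_greatest[OF False])
          fix q assume q: "q \<in> C"
          have "u (\<lambda>z. c * f z) \<le> q (\<lambda>z. c * f z)" using le[OF fun_subspaceD(3)[OF V f] q] .
          also have "\<dots> \<le> c * q f" using CS q f c by (auto simp: S_def sublinear_on_def)
          finally show "u (\<lambda>z. c * f z) / c \<le> q f" using c by (simp add: field_simps)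
        qed
        then show "u (\<lambda>z. c * f z) \<le> c * u f" using c by (simp add: field_simps)
      qed
      obtain q0 where q0: "q0 \<in> C" using False by auto
      have "(\<lambda>f. if f \<in> V then u f else 0) \<in> S"
        using sub le[OF _ q0] q0 CS by (fastforce simp: S_def restrict)
      moreover have "P a (\<lambda>f. if f \<in> V then u f else 0)" if "a \<in> C" for a
        using that CS le by (auto simp: P_def le_fun_def S_def)
      ultimately show ?thesis by blast
    qed
  qed
  then obtain m where m: "m \<in> S" and min: "\<And>a. a \<in> S \<Longrightarrow> P m a \<Longrightarrow> a = m" by blast
  have "q f = m f" if q: "sublinear_on V q" "\<forall>f\<in>V. q f \<le> m f" and f: "f \<in> V" for q f
  proof -
    have "(\<lambda>f. if f \<in> V then q f else 0) = m"
    proof (rule min)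
      show "(\<lambda>f. if f \<in> V then q f else 0) \<in> S"
        using q m by (auto simp: S_def restrict intro: order_trans)
      show "P m (\<lambda>f. if f \<in> V then q f else 0)"
        using q m by (auto simp: P_def S_def le_fun_def)
    qed
    then show "q f = m f" using f by (auto dest: fun_cong[of _ _ f])
  qed
  then show ?thesis using m by (intro exI[of _ m]) (simp add: S_def)
qed

text \<open>Let \<open>m\<close> be minimal. For fixed \<open>x\<close> the functional
  \<open>q y\<close>, the infimum over \<open>t \<ge> 0\<close> of
  \<open>m (y + t x) - t m x\<close>, is sublinear and at most \<open>m\<close>, hence equal to
  \<open>m\<close> by minimality. The value \<open>t = 1\<close> then reads
  \<open>m y + m x \<le> m (y + x)\<close>, so \<open>m\<close> is superadditive as well as
  subadditive.\<close>

theorem Hahn_Banach_functions: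
  assumes V: "fun_subspace V" and p: "sublinear_on V p"
  obtains L where "linear_functional_on V L" "\<And>f. f \<in> V \<Longrightarrow> L f \<le> p f"
proof -
  from minimal_sublinear_exists[OF V p] obtain m where mm: "sublinear_on V m \<and> (\<forall>f\<in>V. m f \<le> p f) \<and>
    (\<forall>q. sublinear_on V q \<longrightarrow> (\<forall>f\<in>V. q f \<le> m f) \<longrightarrow> (\<forall>f\<in>V. q f = m f))" ..
  note m = conjunct1[OF mm] conjunct1[OF conjunct2[OF mm]]
    and min = conjunct2[OF conjunct2[OF mm], rule_format]
  note sp = fun_subspaceD[OF V]
  have super: "m y + m x \<le> m (\<lambda>z. y z + x z)" if x: "x \<in> V" and y: "y \<in> V" for x y
  proof -
    define a where "a y t = m (\<lambda>z. y z + t * x z) - t * m x" for y t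
    define q where "q y = (INF t\<in>{0..}. a y t)" for y
    have mx: "t * m x = m (\<lambda>z. t * x z)" if "t \<ge> 0" for t
      using that sublinear_on_scale[OF V m(1) x, of t] sublinear_on_zero[OF V m(1)] by (cases "t = 0") auto
    \<comment> \<open>The infimum over all \<open>t\<close> is finite because
      \<open>t m x = m (t x) \<le> m (y + t x) + m (- y)\<close>.\<close>
    have lower: "- m (\<lambda>z. - y z) \<le> a y t" if y: "y \<in> V" and t: "t \<in> {0..}" for y t
    proof -
      have "m (\<lambda>z. (y z + t * x z) + (-1) * y z) \<le> m (\<lambda>z. y z + t * x z) + m (\<lambda>z. (-1) * y z)"
        using x y by (intro sublinear_onD(1)[OF m(1)] sp)
      then show ?thesis using mx[of t] t by (simp add: a_def)
    qed
    have le: "q y \<le> a y t" if "y \<in> V" "t \<ge> 0" for y t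
      unfolding q_def using lower that by (intro cINF_lower bdd_belowI2[where m = "- m (\<lambda>z. - y z)"]) auto
    have "sublinear_on V q"
      unfolding sublinear_on_def
    proof (intro conjI ballI allI impI)
      fix f g assume fg: "f \<in> V" "g \<in> V"
      \<comment> \<open>Parameters \<open>t\<close> for \<open>f\<close> and \<open>s\<close> for
        \<open>g\<close> combine to \<open>t + s\<close> for the sum; likewise \<open>c * t\<close>
        serves the multiple \<open>c f\<close> below.\<close>
      have *: "q (\<lambda>z. f z + g z) \<le> a f t + a g s" if "t \<ge> 0" "s \<ge> 0" for t s
      proof -
        have "q (\<lambda>z. f z + g z) \<le> a (\<lambda>z. f z + g z) (t + s)" using le[OF sp(2)[OF fg], of "t + s"] that by simp
        also have "\<dots> \<le> a f t + a g s"
          using sublinear_onD(1)[OF m(1) sp(2)[OF fg(1) sp(3)[OF x, of t]] sp(2)[OF fg(2) sp(3)[OF x, of s]]]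
          by (simp add: a_def algebra_simps)
        finally show ?thesis .
      qed
      have "q (\<lambda>z. f z + g z) - a f t \<le> q g" if "t \<ge> 0" for t
        unfolding q_def[of g] using *[OF that] by (intro cINF_greatest) (auto simp: algebra_simps)
      then have "q (\<lambda>z. f z + g z) - q g \<le> q f"
        unfolding q_def[of f] by (intro cINF_greatest) (auto simp: algebra_simps)
      then show "q (\<lambda>z. f z + g z) \<le> q f + q g" by simp
    next
      fix f and c :: real assume f: "f \<in> V" and c: "c > 0"
      have "q (\<lambda>z. c * f z) / c \<le> q f"
        unfolding q_def[of f]
      proof (rule cINF_greatest)
        fix t :: real assume t: "t \<in> {0..}"
        have "q (\<lambda>z. c * f z) \<le> a (\<lambda>z. c * f z) (c * t)" using le[OF sp(3)[OF f], of "c * t" c] c t by simp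
        also have "\<dots> \<le> c * a f t"
          using sublinear_onD(2)[OF m(1) sp(2)[OF f sp(3)[OF x, of t]] c] by (simp add: a_def algebra_simps)
        finally show "q (\<lambda>z. c * f z) / c \<le> a f t" using c by (simp add: field_simps)
      qed simp
      then show "q (\<lambda>z. c * f z) \<le> c * q f" using c by (simp add: field_simps)
    qed
    moreover have "q f \<le> m f" if "f \<in> V" for f using le[OF that, of 0] by (simp add: a_def)
    ultimately have "q y = m y" using y by (rule min)
    then show ?thesis using le[OF y, of 1] by (simp add: a_def)
  qed
  have add: "m (\<lambda>z. f z + g z) = m f + m g" if "f \<in> V" "g \<in> V" for f g
    using super[OF that(2,1)] sublinear_onD(1)[OF m(1) that] by simp
  have neg: "m (\<lambda>z. - f z) = - m f" if f: "f \<in> V" for f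
    using add[OF f sp(3)[OF f, of "-1"]] sublinear_on_zero[OF V m(1)] by simp
  have "m (\<lambda>z. c * f z) = c * m f" if f: "f \<in> V" for f c
  proof -
    consider "c > 0" | "c = 0" | "c < 0" by linarith
    then show ?thesis
    proof cases
      case 3
      have "m (\<lambda>z. c * f z) = - m (\<lambda>z. (-c) * f z)" using neg[OF sp(3)[OF f, of "-c"]] by simp
      then show ?thesis using sublinear_on_scale[OF V m(1) f, of "-c"] 3 by simp
    qed (use sublinear_on_scale[OF V m(1) f] sublinear_on_zero[OF V m(1)] in auto)
  qed
  with add have "linear_functional_on V m" by (simp add: linear_functional_on_def)
  then show thesis by (rule that) (use m(2) in blast)
qed

text \<open>\<open>(h, r) \<in> K\<close> encodes the requirement \<open>L h \<le> r\<close>.\<close>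
lemma monotone_functional_exists:
  fixes K :: "(('i \<Rightarrow> real) \<times> real) set" and Z :: "'i set"
  assumes zero: "((\<lambda>z. 0), 0) \<in> K"
    and add: "\<And>h r h' r'. (h, r) \<in> K \<Longrightarrow> (h', r') \<in> K \<Longrightarrow> ((\<lambda>z. h z + h' z), r + r') \<in> K"
    and scale: "\<And>h r c. (h, r) \<in> K \<Longrightarrow> c > 0 \<Longrightarrow> ((\<lambda>z. c * h z), c * r) \<in> K"
    and consistent: "\<And>h r. (h, r) \<in> K \<Longrightarrow> (\<And>z. z \<in> Z \<Longrightarrow> 0 \<le> h z) \<Longrightarrow> 0 \<le> r"
    and V_def: "V = {f. \<exists>(h, r)\<in>K. \<forall>z\<in>Z. \<bar>f z\<bar> \<le> h z}"
  shows "fun_subspace V \<and> (\<exists>L. linear_functional_on V L \<and>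
    (\<forall>f\<in>V. \<forall>g\<in>V. (\<forall>z\<in>Z. f z \<le> g z) \<longrightarrow> L f \<le> L g) \<and>
    (\<forall>h r. (h, r) \<in> K \<longrightarrow> (\<forall>f\<in>V. (\<forall>z\<in>Z. f z \<le> h z) \<longrightarrow> L f \<le> r)))"
proof -
  have memV: "f \<in> V" if "(h, r) \<in> K" "\<And>z. z \<in> Z \<Longrightarrow> \<bar>f z\<bar> \<le> h z" for f h r
    using that unfolding V_def by blast
  have V: "fun_subspace V"
    unfolding fun_subspace_def
  proof (intro conjI ballI allI)
    show "(\<lambda>z. 0) \<in> V" using memV[OF zero] by simp
  next
    fix f g assume "f \<in> V" "g \<in> V"
    then obtain h r h' r' where *: "(h, r) \<in> K" "\<forall>z\<in>Z. \<bar>f z\<bar> \<le> h z" "(h', r') \<in> K" "\<forall>z\<in>Z. \<bar>g z\<bar> \<le> h' z"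
      by (auto simp: V_def)
    have "\<bar>f z + g z\<bar> \<le> h z + h' z" if "z \<in> Z" for z
      using *(2,4) that by (meson abs_triangle_ineq add_mono order_trans)
    then show "(\<lambda>z. f z + g z) \<in> V" by (rule memV[OF add[OF *(1,3)]])
  next
    fix f and c :: real assume "f \<in> V"
    then obtain h r where *: "(h, r) \<in> K" "\<forall>z\<in>Z. \<bar>f z\<bar> \<le> h z" by (auto simp: V_def)
    \<comment> \<open>The factor \<open>\<bar>c\<bar> + 1\<close> is used because
      \<open>scale\<close> asks for a strictly positive one; \<open>h\<close> is nonnegative on
      \<open>Z\<close> since it dominates \<open>\<bar>f\<bar>\<close>.\<close>
    have "\<bar>c * f z\<bar> \<le> (\<bar>c\<bar> + 1) * h z" if "z \<in> Z" for z
      unfolding abs_mult using *(2) that by (intro mult_mono) auto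
    moreover have "((\<lambda>z. (\<bar>c\<bar> + 1) * h z), (\<bar>c\<bar> + 1) * r) \<in> K"
      by (rule scale[OF *(1)]) (simp add: add_nonneg_pos)
    ultimately show "(\<lambda>z. c * f z) \<in> V" by - (rule memV)
  qed
  \<comment> \<open>\<open>R f\<close> collects the bounds that the constraints impose on
    \<open>L f\<close> through a function above \<open>f\<close> on \<open>Z\<close>; their infimum
    \<open>p\<close> is the sublinear majorant to which Hahn-Banach is applied.\<close>
  define R where "R f = {r. \<exists>h. (h, r) \<in> K \<and> (\<forall>z\<in>Z. f z \<le> h z)}" for f
  define p where "p f = Inf (R f)" for f
  have bdd: "bdd_below (R f)" if f: "f \<in> V" for f
  proof -
    obtain h r where h: "(h, r) \<in> K" "\<forall>z\<in>Z. \<bar>f z\<bar> \<le> h z" using f by (auto simp: V_def)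
    \<comment> \<open>From \<open>- f \<le> h\<close> and \<open>f \<le> h'\<close> on
      \<open>Z\<close> the sum \<open>h + h'\<close> is nonnegative there, and consistency yields
      \<open>r + r' \<ge> 0\<close>.\<close>
    have "- r \<le> r'" if r': "r' \<in> R f" for r'
    proof -
      obtain h' where h': "(h', r') \<in> K" "\<forall>z\<in>Z. f z \<le> h' z" using r' by (auto simp: R_def)
      have "0 \<le> r + r'" using h h' by (intro consistent[OF add[OF h(1) h'(1)]]) force
      then show ?thesis by simp
    qed
    then show ?thesis by (rule bdd_belowI)
  qed
  have ne: "R f \<noteq> {}" if "f \<in> V" for f
    using that by (fastforce simp: V_def R_def)
  have le: "p f \<le> r" if "f \<in> V" "r \<in> R f" for f r
    unfolding p_def using bdd that by (intro cInf_lower)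
  have "sublinear_on V p"
    unfolding sublinear_on_def
  proof (intro conjI ballI allI impI)
    fix f g assume fg: "f \<in> V" "g \<in> V"
    have *: "p (\<lambda>z. f z + g z) \<le> r + r'" if "r \<in> R f" "r' \<in> R g" for r r'
    proof (rule le[OF fun_subspaceD(2)[OF V fg]])
      obtain h h' where "(h, r) \<in> K" "\<forall>z\<in>Z. f z \<le> h z" "(h', r') \<in> K" "\<forall>z\<in>Z. g z \<le> h' z"
        using \<open>r \<in> R f\<close> \<open>r' \<in> R g\<close> by (auto simp: R_def)
      then show "r + r' \<in> R (\<lambda>z. f z + g z)"
        using add[of h r h' r'] by (force simp: R_def intro!: add_mono)
    qed
    have "p (\<lambda>z. f z + g z) - r \<le> p g" if "r \<in> R f" for r
      unfolding p_def[of g] using ne[OF fg(2)] *[OF that] by (intro cInf_greatest) (auto simp: algebra_simps)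
    then have "p (\<lambda>z. f z + g z) - p g \<le> p f"
      unfolding p_def[of f] using ne[OF fg(1)] by (intro cInf_greatest) (auto simp: algebra_simps)
    then show "p (\<lambda>z. f z + g z) \<le> p f + p g" by simp
  next
    fix f and c :: real assume f: "f \<in> V" and c: "c > 0"
    have "p (\<lambda>z. c * f z) / c \<le> p f"
      unfolding p_def[of f]
    proof (rule cInf_greatest[OF ne[OF f]])
      fix r assume "r \<in> R f"
      then obtain h where h: "(h, r) \<in> K" "\<forall>z\<in>Z. f z \<le> h z" by (auto simp: R_def)
      have "c * r \<in> R (\<lambda>z. c * f z)" using scale[OF h(1) c] h(2) c by (force simp: R_def)
      then show "p (\<lambda>z. c * f z) / c \<le> r"
        using le[OF fun_subspaceD(3)[OF V f]] c by (simp add: field_simps)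
    qed
    then show "p (\<lambda>z. c * f z) \<le> c * p f" using c by (simp add: field_simps)
  qed
  then obtain L where L: "linear_functional_on V L" "\<And>f. f \<in> V \<Longrightarrow> L f \<le> p f"
    using Hahn_Banach_functions[OF V] by blast
  show ?thesis
  proof (intro conjI exI[of _ L] V L(1) ballI allI impI)
    fix h r f assume "(h, r) \<in> K" "f \<in> V" "\<forall>z\<in>Z. f z \<le> h z"
    then show "L f \<le> r" using L(2)[of f] le[of f r] by (force simp: R_def)
  next
    fix f g assume fg: "f \<in> V" "g \<in> V" and fgle: "\<forall>z\<in>Z. f z \<le> g z"
    have d: "(\<lambda>z. f z + (-1) * g z) \<in> V" by (intro fun_subspaceD[OF V] fg)
    \<comment> \<open>The difference \<open>f - g\<close> is dominated by the zero constraint, so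
      monotonicity comes from the same majorant.\<close>
    have "0 \<in> R (\<lambda>z. f z + (-1) * g z)" using zero fgle by (force simp: R_def)
    then have "L (\<lambda>z. f z + (-1) * g z) \<le> 0" using L(2)[OF d] le[OF d] by force
    moreover have "L (\<lambda>z. f z + (-1) * g z) = L f + (-1) * L g"
      using linear_functional_onD(1)[OF L(1) fg(1) fun_subspaceD(3)[OF V fg(2), of "-1"]]
        linear_functional_onD(2)[OF L(1) fg(2), of "-1"] by simp
    ultimately show "L f \<le> L g" by simp
  qed
qed

section \<open>Lipschitz functions and quantization of measures\<close>

text \<open>Closed balls of integer radius about a base point are compact, hence totally bounded;
  the union of finite nets of mesh \<open>1 / (m + 1)\<close> in all of them is countable and dense.
  The sequence later quantizes measures, makes \<open>dist\<close> measurable on the product and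
  shows that the support has full measure.\<close>

lemma proper_space_dense_sequence:
  assumes "proper_space TYPE('a::metric_space)"
  obtains s :: "nat \<Rightarrow> 'a::metric_space" where "\<And>x e. e > 0 \<Longrightarrow> \<exists>n. dist x (s n) < e"
proof -
  fix x0 :: 'a
  have "\<exists>k. finite k \<and> cball x0 (real n) \<subseteq> (\<Union>x\<in>k. ball x (1 / real (Suc m)))" for n m
    using assms compact_eq_totally_bounded[of "cball x0 (real n)"] by (simp add: proper_space_def)
  then obtain k where k: "\<And>n m. finite (k n m)"
      "\<And>n m. cball x0 (real n) \<subseteq> (\<Union>x\<in>k n m. ball x (1 / real (Suc m)))"
    by metis
  define D where "D = (\<Union>n. \<Union>m. k n m)"
  have D: "\<exists>y\<in>D. dist x y < e" if e: "e > 0" for x e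
  proof -
    obtain m where m: "1 / real (Suc m) < e" by (rule nat_approx_posE[OF e])
    obtain n where "dist x0 x \<le> real n" using real_arch_simple by blast
    then obtain y where "y \<in> k n m" "dist y x < 1 / real (Suc m)" using k(2)[of n m] by auto
    then have "y \<in> D" "dist x y < e" using m by (auto simp: D_def dist_commute)
    then show ?thesis ..
  qed
  have "countable D" using k(1) by (auto simp: D_def countable_finite)
  show thesis
  proof (rule that[of "from_nat_into D"])
    fix x and e :: real assume "e > 0"
    from D[OF this, of x] obtain y where y: "y \<in> D" "dist x y < e" ..
    from from_nat_into_surj[OF \<open>countable D\<close> y(1)] obtain n where "from_nat_into D n = y" ..
    with y(2) show "\<exists>n. dist x (from_nat_into D n) < e" by auto
  qed
qed

lemma lipschitz_1_abs_le: "1-lipschitz_on UNIV f \<Longrightarrow> \<bar>f x - f y\<bar> \<le> dist x y" for f :: "'a::metric_space \<Rightarrow> real"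
  using lipschitz_onD[of 1 UNIV f x y] by (simp add: dist_real_def)

lemma lipschitz_1I:
  fixes f :: "'a::metric_space \<Rightarrow> real"
  assumes "\<And>x y. f x - f y \<le> dist x y"
  shows "1-lipschitz_on UNIV f"
proof (rule lipschitz_onI)
  fix x y show "dist (f x) (f y) \<le> 1 * dist x y"
    using assms[of x y] assms[of y x] by (simp add: dist_real_def dist_commute abs_le_iff)
qed simp

text \<open>The definition provides the first moment about a single base point. By the triangle
  inequality another base point adds only the constant \<open>dist x x0\<close>, which is integrable
  for a probability measure.\<close>

lemma P1D:
  assumes "P1 M"
  shows "prob_space M" "sets M = sets borel" "space M = UNIV" "integrable M (\<lambda>y. dist x y)"
    "integrable M (\<lambda>y. dist y x)"
proof -
  show M: "prob_space M" "sets M = sets borel" using assms by (auto simp: P1_def)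
  then show "space M = UNIV" using sets_eq_imp_space_eq[OF M(2)] by simp
  interpret prob_space M by fact
  obtain x0 where x0: "integrable M (\<lambda>y. dist x0 y)" using assms by (auto simp: P1_def)
  have "(\<lambda>y. dist x y) \<in> borel_measurable borel"
    by (intro borel_measurable_continuous_onI continuous_intros)
  then have "(\<lambda>y. dist x y) \<in> borel_measurable M" using M(2) measurable_cong_sets by blast
  moreover have "norm (dist x y) \<le> norm (dist x x0 + dist x0 y)" for y
    using dist_triangle[of x y x0] by simp
  moreover have "integrable M (\<lambda>y. dist x x0 + dist x0 y)" using x0 by simp
  ultimately show "integrable M (\<lambda>y. dist x y)"
    by (metis (mono_tags, lifting) AE_I2 Bochner_Integration.integrable_bound)
  then show "integrable M (\<lambda>y. dist y x)" by (simp add: dist_commute)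
qed

lemma P1_measurable_borel: "P1 M \<Longrightarrow> f \<in> borel \<rightarrow>\<^sub>M N \<Longrightarrow> f \<in> M \<rightarrow>\<^sub>M N"
  using P1D(2)[of M] measurable_cong_sets by blast

lemma lipschitz_borel_measurable:
  fixes f :: "'a::metric_space \<Rightarrow> real"
  assumes "1-lipschitz_on UNIV f"
  shows "f \<in> borel_measurable borel"
  using lipschitz_on_continuous_on[OF assms] by (rule borel_measurable_continuous_onI)

lemma integrable_lipschitz_P1:
  fixes f :: "'a::metric_space \<Rightarrow> real"
  assumes M: "P1 M" and f: "1-lipschitz_on UNIV f"
  shows "integrable M f"
proof -
  fix x0 :: 'a
  interpret prob_space M using P1D(1)[OF M] .
  have "f \<in> borel_measurable M"
    using P1_measurable_borel[OF M lipschitz_borel_measurable[OF f]] .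
  moreover have "\<bar>f x\<bar> \<le> \<bar>f x0\<bar> + dist x0 x" for x
    using lipschitz_1_abs_le[OF f, of x0 x] by linarith
  moreover have "integrable M (\<lambda>x. \<bar>f x0\<bar> + dist x0 x)"
    using P1D(4)[OF M] by simp
  ultimately show ?thesis
    by (intro Bochner_Integration.integrable_bound[of M "\<lambda>x. \<bar>f x0\<bar> + dist x0 x" f]) auto
qed

text \<open>The bound does not depend on \<open>f\<close>. It makes integration a bounded function
  on the set of normalised potentials.\<close>

lemma integral_lipschitz_P1_le:
  fixes f :: "'a::metric_space \<Rightarrow> real"
  assumes M: "P1 M" and f: "1-lipschitz_on UNIV f"
  shows "\<bar>(\<integral>x. f x \<partial>M) - f x0\<bar> \<le> (\<integral>x. dist x0 x \<partial>M)"
proof -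
  interpret prob_space M using P1D(1)[OF M] .
  have "(\<integral>x. f x \<partial>M) - f x0 = (\<integral>x. f x - f x0 \<partial>M)"
    using integrable_lipschitz_P1[OF M f] by (simp add: prob_space)
  also have "\<bar>\<dots>\<bar> \<le> (\<integral>x. \<bar>f x - f x0\<bar> \<partial>M)" by (rule integral_abs_bound)
  also have "\<dots> \<le> (\<integral>x. dist x0 x \<partial>M)"
    using integrable_lipschitz_P1[OF M f] P1D(4)[OF M, of x0] lipschitz_1_abs_le[OF f, of _ x0]
    by (intro integral_mono) (simp_all add: dist_commute)
  finally show ?thesis .
qed

section \<open>Quantization of a measure by nearest sample points\<close>

text \<open>This is the index of a closest point among \<open>s 0, ..., s n\<close>, with ties
  resolved in favour of the smaller index. The recursive form lets measurability of the resulting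
  finite partition follow by induction.\<close>

fun nearest :: "(nat \<Rightarrow> 'a::metric_space) \<Rightarrow> nat \<Rightarrow> 'a \<Rightarrow> nat" where
  "nearest s 0 x = 0"
| "nearest s (Suc n) x = (if dist x (s (Suc n)) < dist x (s (nearest s n x)) then Suc n else nearest s n x)"

lemma nearest_le: "nearest s n x \<le> n"
  by (induction n) (auto intro: le_SucI)

lemma dist_nearest_le: "m \<le> n \<Longrightarrow> dist x (s (nearest s n x)) \<le> dist x (s m)"
proof (induction n)
  case (Suc n) then show ?case by (cases "m = Suc n") auto
qed simp

lemma measurable_dist_left [measurable]: "(\<lambda>x::'a::metric_space. dist x a) \<in> borel_measurable borel"
  by (intro borel_measurable_continuous_onI continuous_intros)

lemma nearest_measurable [measurable]: "nearest s n \<in> borel \<rightarrow>\<^sub>M count_space UNIV"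
proof (induction n)
  case (Suc n)
  note [measurable] = Suc
  have [measurable]: "(\<lambda>x. dist x (s (nearest s n x))) \<in> borel_measurable borel"
    by (rule measurable_compose_countable[where f = "\<lambda>i x. dist x (s i)"]) measurable
  have "(\<lambda>x. if dist x (s (Suc n)) < dist x (s (nearest s n x)) then Suc n else nearest s n x)
      \<in> borel \<rightarrow>\<^sub>M count_space UNIV" by measurable
  then show ?case by simp
qed simp

lemma measurable_dist_nearest [measurable]:
  "(\<lambda>x. dist x (s (nearest s n x))) \<in> borel_measurable borel"
  by (rule measurable_compose_countable[where f = "\<lambda>i x. dist x (s i)"]) measurable

lemma dist_nearest_tendsto:
  assumes dense: "\<And>x e. e > 0 \<Longrightarrow> \<exists>n. dist x (s n) < e"
  shows "(\<lambda>n. dist x (s (nearest s n x))) \<longlonglongrightarrow> 0"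
proof (rule LIMSEQ_I)
  fix e :: real assume "e > 0"
  then obtain m where "dist x (s m) < e" using dense by blast
  then show "\<exists>m. \<forall>n\<ge>m. norm (dist x (s (nearest s n x)) - 0) < e"
    using dist_nearest_le[of m _ x s] by (intro exI[of _ m]) (auto intro: le_less_trans)
qed

lemma integrable_dist_nearest:
  assumes M: "P1 M"
  shows "integrable M (\<lambda>x. dist x (s (nearest s n x)))"
  using dist_nearest_le[of 0 n _ s] P1_measurable_borel[OF M measurable_dist_nearest]
  by (intro Bochner_Integration.integrable_bound[OF P1D(5)[OF M, of "s 0"]]) auto

text \<open>Dominated convergence: density gives pointwise convergence to 0, and the index 0 is
  always a candidate, so \<open>dist x (s 0)\<close> is an integrable majorant.\<close>

lemma quantization_error_small:
  assumes dense: "\<And>x e. e > 0 \<Longrightarrow> \<exists>n. dist x (s n) < e" and M: "P1 M" and e: "e > 0"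
  shows "\<exists>n. (\<integral>x. dist x (s (nearest s n x)) \<partial>M) < e"
proof -
  have "(\<lambda>n. \<integral>x. dist x (s (nearest s n x)) \<partial>M) \<longlonglongrightarrow> (\<integral>x. 0 \<partial>M)"
  proof (rule integral_dominated_convergence)
    show "integrable M (\<lambda>x. dist x (s 0))" using P1D(5)[OF M] .
    show "(\<lambda>x. dist x (s (nearest s n x))) \<in> borel_measurable M" for n
      using P1_measurable_borel[OF M measurable_dist_nearest] .
    show "AE x in M. (\<lambda>n. dist x (s (nearest s n x))) \<longlonglongrightarrow> 0"
      by (intro AE_I2 dist_nearest_tendsto dense)
    show "AE x in M. norm (dist x (s (nearest s n x))) \<le> dist x (s 0)" for n
      using dist_nearest_le[of 0 n _ s] by simp
  qed simp
  then have "(\<lambda>n. \<integral>x. dist x (s (nearest s n x)) \<partial>M) \<longlonglongrightarrow> 0" by simp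
  then have "eventually (\<lambda>n. (\<integral>x. dist x (s (nearest s n x)) \<partial>M) < e) sequentially"
    using e by (rule order_tendstoD)
  then show ?thesis by (rule eventually_happens'[OF sequentially_bot])
qed

text \<open>The sigma-algebra here is the product of the Borel ones, for which continuity of
  \<open>dist\<close> alone does not give measurability. Replacing the second argument by its
  nearest sample point leaves countably many cases, each measurable, and the limit is
  \<open>dist\<close>.\<close>

lemma measurable_dist_pair_borel:
  fixes s :: "nat \<Rightarrow> 'a::metric_space"
  assumes dense: "\<And>x e. e > 0 \<Longrightarrow> \<exists>n. dist x (s n) < e"
  shows "(\<lambda>p::'a \<times> 'a. dist (fst p) (snd p)) \<in> borel_measurable (borel \<Otimes>\<^sub>M borel)"
proof (rule borel_measurable_LIMSEQ_real)
  fix p :: "'a \<times> 'a"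
  show "(\<lambda>n. dist (fst p) (s (nearest s n (snd p)))) \<longlonglongrightarrow> dist (fst p) (snd p)" 
  proof -
    have "(\<lambda>n. s (nearest s n (snd p))) \<longlonglongrightarrow> snd p"
      using dist_nearest_tendsto[of "s" "snd p", OF dense] by (subst tendsto_dist_iff) (simp add: dist_commute)
    then show ?thesis by (intro tendsto_intros)
  qed
next
  fix n
  show "(\<lambda>p::'a \<times> 'a. dist (fst p) (s (nearest s n (snd p)))) \<in> borel_measurable (borel \<Otimes>\<^sub>M borel)"
    by (rule measurable_compose_countable[where f = "\<lambda>i p. dist (fst p) (s i)"]) measurable
qed

section \<open>Kantorovich-Rubinstein duality\<close>

text \<open>The integrand is constant on cells, and a cell of positive measure contributes
  \<open>p b\<close> after cancellation. On a null cell \<open>p b\<close> vanishes and division by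
  zero yields 0, so nothing is lost.\<close>

lemma nn_integral_cell_weights:
  fixes q :: "'a \<Rightarrow> nat" and p :: "nat \<Rightarrow> real"
  assumes M: "finite_measure M" and q: "q \<in> M \<rightarrow>\<^sub>M count_space UNIV" "\<And>x. q x \<le> n"
    and p: "\<And>b. 0 \<le> p b" "\<And>b. measure M {x\<in>space M. q x = b} = 0 \<Longrightarrow> p b = 0"
  shows "(\<integral>\<^sup>+x. ennreal (p (q x) / measure M {y\<in>space M. q y = q x}) \<partial>M) = ennreal (\<Sum>b\<le>n. p b)"
proof -
  interpret finite_measure M by fact
  define C where "C b = {x\<in>space M. q x = b}" for b
  note [measurable] = q(1)
  have C[measurable]: "C b \<in> sets M" for b unfolding C_def by measurable
  have eq: "ennreal (p (q x) / measure M (C (q x))) = (\<Sum>b\<le>n. ennreal (p b / measure M (C b)) * indicator (C b) x)"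
    if "x \<in> space M" for x
  proof -
    have "(\<Sum>b\<le>n. ennreal (p b / measure M (C b)) * indicator (C b) x)
      = (\<Sum>b\<le>n. if b = q x then ennreal (p b / measure M (C b)) else 0)"
      using that by (intro sum.cong) (auto simp: C_def indicator_def)
    then show ?thesis using q(2)[of x] by simp
  qed
  have "(\<integral>\<^sup>+x. ennreal (p (q x) / measure M (C (q x))) \<partial>M)
      = (\<integral>\<^sup>+x. (\<Sum>b\<le>n. ennreal (p b / measure M (C b)) * indicator (C b) x) \<partial>M)"
    by (rule nn_integral_cong) (rule eq)
  also have "\<dots> = (\<Sum>b\<le>n. \<integral>\<^sup>+x. ennreal (p b / measure M (C b)) * indicator (C b) x \<partial>M)"
    by (rule nn_integral_sum) measurable
  also have "\<dots> = (\<Sum>b\<le>n. ennreal (p b))"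
  proof (rule sum.cong)
    fix b
    have "(\<integral>\<^sup>+x. ennreal (p b / measure M (C b)) * indicator (C b) x \<partial>M)
        = ennreal (p b / measure M (C b)) * ennreal (measure M (C b))"
      by (subst nn_integral_cmult_indicator) (auto simp: emeasure_eq_measure)
    also have "\<dots> = ennreal (p b)"
      using p[of b] by (cases "measure M (C b) = 0") (auto simp: C_def ennreal_mult[symmetric])
    finally show "(\<integral>\<^sup>+x. ennreal (p b / measure M (C b)) * indicator (C b) x \<partial>M) = ennreal (p b)" .
  qed simp
  also have "\<dots> = ennreal (\<Sum>b\<le>n. p b)" using p(1) by (simp add: sum_ennreal)
  finally show ?thesis by (simp add: C_def)
qed

text \<open>Cells are indexed by natural numbers, so the null ones together form a countable union
  of null sets.\<close>

lemma AE_cell_nonnull: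
  fixes q :: "'a \<Rightarrow> nat"
  assumes M: "finite_measure M" and q[measurable]: "q \<in> M \<rightarrow>\<^sub>M count_space UNIV"
  shows "AE x in M. measure M {y\<in>space M. q y = q x} \<noteq> 0"
proof -
  interpret finite_measure M by fact
  have "AE x in M. q x = a \<longrightarrow> measure M {y\<in>space M. q y = a} \<noteq> 0" for a
  proof (cases "measure M {y\<in>space M. q y = a} = 0")
    case True
    then have "{y\<in>space M. q y = a} \<in> null_sets M"
      by (intro null_setsI) (simp_all add: emeasure_eq_measure)
    then show ?thesis by (rule AE_I') blast
  qed simp
  then have "AE x in M. \<forall>a. q x = a \<longrightarrow> measure M {y\<in>space M. q y = a} \<noteq> 0"
    unfolding AE_all_countable by blast
  then show ?thesis by simp
qed

text \<open>Since \<open>enn2real\<close> sends infinity to 0, it is monotone only below a finite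
  bound; the real number \<open>c\<close> provides one.\<close>

lemma W1_le_coupling:
  assumes "P \<in> couplings A B" and "(\<integral>\<^sup>+ p. ennreal (dist (fst p) (snd p)) \<partial>P) \<le> ennreal c" and "0 \<le> c"
  shows "W1 A B \<le> c"
proof -
  have "(\<Sqinter>\<pi>\<in>couplings A B. \<integral>\<^sup>+ p. ennreal (dist (fst p) (snd p)) \<partial>\<pi>) \<le> ennreal c"
    using assms(1,2) by (rule INF_lower2)
  then have "W1 A B \<le> enn2real (ennreal c)" unfolding W1_def by (rule enn2real_mono) simp
  then show ?thesis using assms(3) by simp
qed

text \<open>A transport plan between the cells of two finite partitions is spread out inside each
  product cell as a multiple of the product measure, so no disintegration is needed.\<close>
lemma W1_le_cell_plan:
  fixes A B :: "'a::metric_space measure" and s :: "nat \<Rightarrow> 'a" and \<pi> :: "nat \<Rightarrow> nat \<Rightarrow> real"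
  assumes dense: "\<And>x e. e > 0 \<Longrightarrow> \<exists>n. dist x (s n) < e"
    and A: "P1 A" and B: "P1 B"
    and k: "k \<in> borel \<rightarrow>\<^sub>M count_space UNIV" "\<And>x. k x \<le> n" "integrable A (\<lambda>x. dist x (s (k x)))"
    and l: "l \<in> borel \<rightarrow>\<^sub>M count_space UNIV" "\<And>x. l x \<le> m" "integrable B (\<lambda>x. dist x (s (l x)))"
    and nonneg: "\<And>a b. 0 \<le> \<pi> a b"
    and row: "\<And>a. (\<Sum>b\<le>m. \<pi> a b) = measure A {x. k x = a}"
    and col: "\<And>b. (\<Sum>a\<le>n. \<pi> a b) = measure B {x. l x = b}"
    and supp: "\<And>a b. \<not> (a \<le> n \<and> b \<le> m) \<Longrightarrow> \<pi> a b = 0"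
  shows "W1 A B \<le> (\<integral>x. dist x (s (k x)) \<partial>A) + (\<Sum>a\<le>n. \<Sum>b\<le>m. \<pi> a b * dist (s a) (s b))
    + (\<integral>x. dist x (s (l x)) \<partial>B)"
proof -
  interpret A: prob_space A using P1D(1)[OF A] .
  interpret B: prob_space B using P1D(1)[OF B] .
  interpret AB: pair_sigma_finite A B ..
  note spA = P1D(3)[OF A] and spB = P1D(3)[OF B]
  note [measurable_cong] = P1D(2)[OF A] P1D(2)[OF B]
  note [measurable] = k(1) l(1) measurable_dist_pair_borel[OF dense]
  define \<alpha> where "\<alpha> a = measure A {x. k x = a}" for a
  define \<beta> where "\<beta> b = measure B {x. l x = b}" for b
  \<comment> \<open>A plan entry is at most its row sum and its column sum. It therefore vanishes on
    null rows and columns, which makes the divisions by \<open>\<alpha>\<close> and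
    \<open>\<beta>\<close> below harmless.\<close>
  have le_row: "\<pi> a b \<le> \<alpha> a" for a b
    using nonneg supp[of a b] row[of a] member_le_sum[of b "{..m}" "\<pi> a"]
    by (cases "b \<le> m") (auto simp: \<alpha>_def)
  have le_col: "\<pi> a b \<le> \<beta> b" for a b
    using nonneg supp[of a b] col[of b] member_le_sum[of a "{..n}" "\<lambda>a. \<pi> a b"]
    by (cases "a \<le> n") (auto simp: \<beta>_def)
  have null: "\<alpha> a = 0 \<Longrightarrow> \<pi> a b = 0" "\<beta> b = 0 \<Longrightarrow> \<pi> a b = 0" for a b
    using le_row[of a b] le_col[of a b] nonneg[of a b] by auto
  have nn: "0 \<le> \<alpha> a" "0 \<le> \<beta> a" for a by (simp_all add: \<alpha>_def \<beta>_def)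
  have cellA: "(\<integral>\<^sup>+x. ennreal (p (k x) / \<alpha> (k x)) \<partial>A) = ennreal (\<Sum>a\<le>n. p a)"
    if "\<And>a. 0 \<le> p a" "\<And>a. \<alpha> a = 0 \<Longrightarrow> p a = 0" for p
    using nn_integral_cell_weights[OF A.finite_measure_axioms, of k n p] k that
    by (simp add: \<alpha>_def spA P1_measurable_borel[OF A])
  have cellB: "(\<integral>\<^sup>+x. ennreal (p (l x) / \<beta> (l x)) \<partial>B) = ennreal (\<Sum>b\<le>m. p b)"
    if "\<And>a. 0 \<le> p a" "\<And>a. \<beta> a = 0 \<Longrightarrow> p a = 0" for p
    using nn_integral_cell_weights[OF B.finite_measure_axioms, of l m p] l that
    by (simp add: \<beta>_def spB P1_measurable_borel[OF B])
  \<comment> \<open>This is the density, constant on product cells, that gives the cell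
    \<open>(a, b)\<close> the mass \<open>\<pi> a b\<close> under the product measure.\<close>
  define h where "h a b = \<pi> a b / (\<alpha> a * \<beta> b)" for a b
  have h0: "0 \<le> h a b" for a b using nonneg nn by (simp add: h_def)
  have [measurable]: "(\<lambda>p. f (k (fst p)) (l (snd p))) \<in> borel_measurable (borel \<Otimes>\<^sub>M borel)" for f :: "nat \<Rightarrow> nat \<Rightarrow> real"
  proof (rule measurable_compose_countable[where f = "\<lambda>i p. f i (l (snd p))"])
    show "(\<lambda>p. f i (l (snd p))) \<in> borel_measurable (borel \<Otimes>\<^sub>M borel)" for i
      by (rule measurable_compose_countable[where f = "\<lambda>j p. f i j"]) measurable
  qed measurable
  define P where "P = density (A \<Otimes>\<^sub>M B) (\<lambda>p. ennreal (h (k (fst p)) (l (snd p))))"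
  have setsP[measurable_cong]: "sets P = sets (borel \<Otimes>\<^sub>M borel)"
    by (simp add: P_def) (intro sets_pair_measure_cong P1D(2)[OF A] P1D(2)[OF B])
  have nnP: "(\<integral>\<^sup>+p. f p \<partial>P) = (\<integral>\<^sup>+p. ennreal (h (k (fst p)) (l (snd p))) * f p \<partial>(A \<Otimes>\<^sub>M B))"
    if "f \<in> borel_measurable (borel \<Otimes>\<^sub>M borel)" for f
    unfolding P_def using that by (intro nn_integral_density) measurable
  have AEk: "AE x in A. \<alpha> (k x) \<noteq> 0"
    using AE_cell_nonnull[OF A.finite_measure_axioms P1_measurable_borel[OF A k(1)]] by (simp add: \<alpha>_def spA)
  have AEl: "AE x in B. \<beta> (l x) \<noteq> 0"
    using AE_cell_nonnull[OF B.finite_measure_axioms P1_measurable_borel[OF B l(1)]] by (simp add: \<beta>_def spB)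
  \<comment> \<open>For fixed \<open>x\<close> in a non-null cell the density integrates over
    \<open>B\<close> to the row sum divided by \<open>\<alpha> (k x)\<close>, that is, to 1. The
    second marginal uses column sums in the same way.\<close>
  have marg1: "(\<integral>\<^sup>+p. g (fst p) \<partial>P) = (\<integral>\<^sup>+x. g x \<partial>A)" if [measurable]: "g \<in> borel_measurable borel" for g
  proof -
    have "(\<integral>\<^sup>+p. g (fst p) \<partial>P) = (\<integral>\<^sup>+x. \<integral>\<^sup>+y. ennreal (h (k x) (l y)) * g x \<partial>B \<partial>A)"
      by (subst nnP, measurable, subst B.nn_integral_fst[symmetric]) auto
    also have "\<dots> = (\<integral>\<^sup>+x. g x \<partial>A)"
    proof (rule nn_integral_cong_AE)
      have "(\<integral>\<^sup>+y. ennreal (h (k x) (l y)) * g x \<partial>B) = g x" if "\<alpha> (k x) \<noteq> 0" for x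
      proof -
        have "(\<integral>\<^sup>+y. ennreal (h (k x) (l y)) * g x \<partial>B) = (\<integral>\<^sup>+y. ennreal (h (k x) (l y)) \<partial>B) * g x"
          by (rule nn_integral_multc) measurable
        also have "(\<integral>\<^sup>+y. ennreal (h (k x) (l y)) \<partial>B) = (\<integral>\<^sup>+y. ennreal ((\<pi> (k x) (l y) / \<alpha> (k x)) / \<beta> (l y)) \<partial>B)"
          by (simp add: h_def)
        also have "\<dots> = ennreal (\<Sum>b\<le>m. \<pi> (k x) b / \<alpha> (k x))"
          using nonneg nn null by (intro cellB) auto
        also have "(\<Sum>b\<le>m. \<pi> (k x) b / \<alpha> (k x)) = 1"
          using that by (simp add: sum_divide_distrib[symmetric] row \<alpha>_def)
        finally show ?thesis by simp
      qed
      then show "AE x in A. (\<integral>\<^sup>+y. ennreal (h (k x) (l y)) * g x \<partial>B) = g x"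
        using AEk by auto
    qed
    finally show ?thesis .
  qed
  have marg2: "(\<integral>\<^sup>+p. g (snd p) \<partial>P) = (\<integral>\<^sup>+y. g y \<partial>B)" if [measurable]: "g \<in> borel_measurable borel" for g
  proof -
    have "(\<integral>\<^sup>+p. g (snd p) \<partial>P) = (\<integral>\<^sup>+y. \<integral>\<^sup>+x. ennreal (h (k x) (l y)) * g y \<partial>A \<partial>B)"
      by (subst nnP, measurable, subst AB.nn_integral_snd[symmetric]) auto
    also have "\<dots> = (\<integral>\<^sup>+y. g y \<partial>B)"
    proof (rule nn_integral_cong_AE)
      have "(\<integral>\<^sup>+x. ennreal (h (k x) (l y)) * g y \<partial>A) = g y" if "\<beta> (l y) \<noteq> 0" for y
      proof -
        have "(\<integral>\<^sup>+x. ennreal (h (k x) (l y)) * g y \<partial>A) = (\<integral>\<^sup>+x. ennreal (h (k x) (l y)) \<partial>A) * g y"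
          by (rule nn_integral_multc) measurable
        also have "(\<integral>\<^sup>+x. ennreal (h (k x) (l y)) \<partial>A) = (\<integral>\<^sup>+x. ennreal ((\<pi> (k x) (l y) / \<beta> (l y)) / \<alpha> (k x)) \<partial>A)"
          by (simp add: h_def mult.commute)
        also have "\<dots> = ennreal (\<Sum>a\<le>n. \<pi> a (l y) / \<beta> (l y))"
          using nonneg nn null by (intro cellA) auto
        also have "(\<Sum>a\<le>n. \<pi> a (l y) / \<beta> (l y)) = 1"
          using that by (simp add: sum_divide_distrib[symmetric] col \<beta>_def)
        finally show ?thesis by simp
      qed
      then show "AE y in B. (\<integral>\<^sup>+x. ennreal (h (k x) (l y)) * g y \<partial>A) = g y"
        using AEl by auto
    qed
    finally show ?thesis .
  qed
  have d1: "distr P borel fst = A"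
  proof (rule measure_eqI)
    show "sets (distr P borel fst) = sets A" using P1D(2)[OF A] by simp
    fix E assume "E \<in> sets (distr P borel fst)"
    then have [measurable]: "E \<in> sets borel" by simp
    have "emeasure (distr P borel fst) E = (\<integral>\<^sup>+p. indicator E (fst p) \<partial>P)"
      by (subst nn_integral_indicator[symmetric], simp) (rule nn_integral_distr; measurable)
    also have "\<dots> = emeasure A E" by (subst marg1) auto
    finally show "emeasure (distr P borel fst) E = emeasure A E" .
  qed
  have d2: "distr P borel snd = B"
  proof (rule measure_eqI)
    show "sets (distr P borel snd) = sets B" using P1D(2)[OF B] by simp
    fix E assume "E \<in> sets (distr P borel snd)"
    then have [measurable]: "E \<in> sets borel" by simp
    have "emeasure (distr P borel snd) E = (\<integral>\<^sup>+p. indicator E (snd p) \<partial>P)"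
      by (subst nn_integral_indicator[symmetric], simp) (rule nn_integral_distr; measurable)
    also have "\<dots> = emeasure B E" by (subst marg2) auto
    finally show "emeasure (distr P borel snd) E = emeasure B E" .
  qed
  have "prob_space P"
    using marg1[of "\<lambda>_. 1"] A.emeasure_space_1 by (intro prob_spaceI) simp
  then have P: "P \<in> couplings A B" using setsP d1 d2 by (simp add: couplings_def)
  define c where "c = (\<Sum>a\<le>n. \<Sum>b\<le>m. \<pi> a b * dist (s a) (s b))"
  have mid: "(\<integral>\<^sup>+p. ennreal (dist (s (k (fst p))) (s (l (snd p)))) \<partial>P) = ennreal c"
  proof -
    have "(\<integral>\<^sup>+p. ennreal (dist (s (k (fst p))) (s (l (snd p)))) \<partial>P)
       = (\<integral>\<^sup>+x. \<integral>\<^sup>+y. ennreal (h (k x) (l y)) * ennreal (dist (s (k x)) (s (l y))) \<partial>B \<partial>A)"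
      by (subst nnP, measurable, subst B.nn_integral_fst[symmetric]) auto
    also have "\<dots> = (\<integral>\<^sup>+x. ennreal ((\<Sum>b\<le>m. \<pi> (k x) b * dist (s (k x)) (s b)) / \<alpha> (k x)) \<partial>A)"
    proof (rule nn_integral_cong)
      fix x
      have "(\<integral>\<^sup>+y. ennreal (h (k x) (l y)) * ennreal (dist (s (k x)) (s (l y))) \<partial>B)
         = (\<integral>\<^sup>+y. ennreal ((\<pi> (k x) (l y) * dist (s (k x)) (s (l y)) / \<alpha> (k x)) / \<beta> (l y)) \<partial>B)"
        by (simp add: h_def ennreal_mult[symmetric] nonneg nn)
      also have "\<dots> = ennreal (\<Sum>b\<le>m. \<pi> (k x) b * dist (s (k x)) (s b) / \<alpha> (k x))"
        using nonneg nn null by (intro cellB) auto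
      finally show "(\<integral>\<^sup>+y. ennreal (h (k x) (l y)) * ennreal (dist (s (k x)) (s (l y))) \<partial>B)
         = ennreal ((\<Sum>b\<le>m. \<pi> (k x) b * dist (s (k x)) (s b)) / \<alpha> (k x))"
        by (simp add: sum_divide_distrib)
    qed
    also have "\<dots> = ennreal c"
      unfolding c_def using nonneg nn null by (intro cellA) (auto intro!: sum_nonneg)
    finally show ?thesis .
  qed
  have [measurable]: "(\<lambda>x. dist x (s (k x))) \<in> borel_measurable borel" "(\<lambda>x. dist x (s (l x))) \<in> borel_measurable borel"
    by (rule measurable_compose_countable[where f = "\<lambda>i x. dist x (s i)"]; measurable)+
  have "(\<integral>\<^sup>+p. ennreal (dist (fst p) (snd p)) \<partial>P)
     \<le> (\<integral>\<^sup>+p. ennreal (dist (fst p) (s (k (fst p)))) + ennreal (dist (s (k (fst p))) (s (l (snd p))))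
          + ennreal (dist (snd p) (s (l (snd p)))) \<partial>P)"
  proof (rule nn_integral_mono)
    fix p :: "'a \<times> 'a"
    \<comment> \<open>The path from one point to the other runs through the representatives of their
      two cells.\<close>
    have "dist (fst p) (snd p) \<le> dist (fst p) (s (k (fst p))) + dist (s (k (fst p))) (s (l (snd p))) + dist (snd p) (s (l (snd p)))"
      using dist_triangle[of "fst p" "snd p" "s (k (fst p))"] dist_triangle[of "s (k (fst p))" "snd p" "s (l (snd p))"]
      by (simp add: dist_commute)
    then show "ennreal (dist (fst p) (snd p)) \<le> ennreal (dist (fst p) (s (k (fst p)))) + ennreal (dist (s (k (fst p))) (s (l (snd p))))
          + ennreal (dist (snd p) (s (l (snd p))))"
      by (simp add: ennreal_plus[symmetric] del: ennreal_plus)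
  qed
  also have "\<dots> = (\<integral>\<^sup>+p. ennreal (dist (fst p) (s (k (fst p)))) \<partial>P) + (\<integral>\<^sup>+p. ennreal (dist (s (k (fst p))) (s (l (snd p)))) \<partial>P)
          + (\<integral>\<^sup>+p. ennreal (dist (snd p) (s (l (snd p)))) \<partial>P)"
    by (subst nn_integral_add; measurable)+
  also have "\<dots> = (\<integral>\<^sup>+x. ennreal (dist x (s (k x))) \<partial>A) + ennreal c + (\<integral>\<^sup>+x. ennreal (dist x (s (l x))) \<partial>B)"
    by (simp add: mid marg1[of "\<lambda>x. ennreal (dist x (s (k x)))"] marg2[of "\<lambda>x. ennreal (dist x (s (l x)))"])
  also have "\<dots> = ennreal ((\<integral>x. dist x (s (k x)) \<partial>A) + c + (\<integral>x. dist x (s (l x)) \<partial>B))"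
    using k(3) l(3) nonneg
    by (simp add: nn_integral_eq_integral c_def sum_nonneg integral_nonneg_AE)
  finally show ?thesis
    unfolding c_def[symmetric]
    by (rule W1_le_coupling[OF P]) (simp add: c_def nonneg sum_nonneg integral_nonneg_AE)
qed

text \<open>The c-transform: \<open>\<phi> \<oplus> \<psi> + t d \<ge> 0\<close> is witnessed by a single 1-Lipschitz function.\<close>
lemma Kantorovich_c_transform:
  fixes A B :: "'a::metric_space measure"
  assumes A: "P1 A" and B: "P1 B"
    and D: "\<And>f. 1-lipschitz_on UNIV f \<Longrightarrow> (\<integral>x. f x \<partial>A) - (\<integral>x. f x \<partial>B) \<le> D"
    and \<phi>: "integrable A \<phi>" and \<psi>: "integrable B \<psi>" and t: "t \<ge> 0"
    and le: "\<And>x y. 0 \<le> \<phi> x + \<psi> y + t * dist x y"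
  shows "0 \<le> (\<integral>x. \<phi> x \<partial>A) + (\<integral>y. \<psi> y \<partial>B) + t * D"
proof (cases "t = 0")
  case True
  interpret A: prob_space A using P1D(1)[OF A] .
  interpret B: prob_space B using P1D(1)[OF B] .
  \<comment> \<open>For \<open>t = 0\<close> the hypothesis is integrated first in \<open>x\<close>
    over \<open>A\<close> and then in \<open>y\<close> over \<open>B\<close>.\<close>
  have *: "- (\<integral>x. \<phi> x \<partial>A) \<le> \<psi> y" for y
  proof -
    have "(\<integral>x. - \<psi> y \<partial>A) \<le> (\<integral>x. \<phi> x \<partial>A)"
    proof (rule integral_mono[OF _ \<phi>])
      fix x show "- \<psi> y \<le> \<phi> x" using le[of x y] True by simp
    qed simp
    then show ?thesis by (simp add: A.prob_space)
  qed
  have "(\<integral>y. - (\<integral>x. \<phi> x \<partial>A) \<partial>B) \<le> (\<integral>y. \<psi> y \<partial>B)"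
    by (rule integral_mono[OF _ \<psi>]) (simp_all add: *)
  then have "- (\<integral>x. \<phi> x \<partial>A) \<le> (\<integral>y. \<psi> y \<partial>B)" by (simp add: B.prob_space)
  then show ?thesis using True by simp
next
  case False
  then have t: "t > 0" using t by simp
  \<comment> \<open>The infimal convolution of \<open>\<psi> / t\<close> with \<open>dist\<close> is
    1-Lipschitz and lies between \<open>- \<phi> / t\<close> and \<open>\<psi> / t\<close>; the
    upper bound is the choice \<open>y = x\<close>.\<close>
  define g where "g x = (INF y. dist x y + \<psi> y / t)" for x
  have lower: "- \<phi> x / t \<le> dist x y + \<psi> y / t" for x y
    using le[of x y] t by (simp add: field_simps)
  have bdd: "bdd_below (range (\<lambda>y. dist x y + \<psi> y / t))" for x
    by (rule bdd_belowI2[where m = "- \<phi> x / t"]) (rule lower)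
  have g_le: "g x \<le> dist x y + \<psi> y / t" for x y
    unfolding g_def by (rule cINF_lower[OF bdd]) simp
  have g_ge: "- \<phi> x / t \<le> g x" for x
    unfolding g_def by (rule cINF_greatest) (simp_all only: lower, simp)
  have g: "1-lipschitz_on UNIV g"
  proof (rule lipschitz_1I)
    fix x y
    have "g x - dist x y \<le> g y"
      unfolding g_def[of y]
    proof (rule cINF_greatest)
      fix z show "g x - dist x y \<le> dist y z + \<psi> z / t"
        using g_le[of x z] dist_triangle[of x z y] by simp
    qed simp
    then show "g x - g y \<le> dist x y" by simp
  qed
  have "- (\<integral>x. \<phi> x \<partial>A) / t \<le> (\<integral>x. g x \<partial>A)"
    using integral_mono[of A "\<lambda>x. - \<phi> x / t" g] \<phi> integrable_lipschitz_P1[OF A g] g_ge by simp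
  moreover have "(\<integral>x. g x \<partial>B) \<le> (\<integral>y. \<psi> y \<partial>B) / t"
    using integral_mono[of B g "\<lambda>y. \<psi> y / t"] \<psi> integrable_lipschitz_P1[OF B g] g_le[of y y for y] by simp
  ultimately have "- (\<integral>x. \<phi> x \<partial>A) / t - (\<integral>y. \<psi> y \<partial>B) / t \<le> D"
    using D[OF g] by simp
  then show ?thesis using t by (simp add: field_simps)
qed

section \<open>The two inequalities of Kantorovich-Rubinstein duality\<close>

text \<open>The constraints in \<open>K\<close> bound a functional on
  \<open>H \<phi> \<psi> t\<close> by \<open>R \<phi> \<psi> t\<close>. For \<open>t = 0\<close>
  both signs of \<open>\<phi>\<close> and \<open>\<psi>\<close> are available, which fixes the
  marginals, whereas \<open>t \<ge> 0\<close> only caps the value on \<open>dist\<close> by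
  \<open>D\<close>. Their consistency is \<open>Kantorovich_c_transform\<close>.\<close>

lemma Kantorovich_Rubinstein_le:
  fixes A B :: "'a::metric_space measure" and s :: "nat \<Rightarrow> 'a"
  assumes dense: "\<And>x e. e > 0 \<Longrightarrow> \<exists>n. dist x (s n) < e"
    and A: "P1 A" and B: "P1 B"
    and D: "\<And>f. 1-lipschitz_on UNIV f \<Longrightarrow> (\<integral>x. f x \<partial>A) - (\<integral>x. f x \<partial>B) \<le> D"
  shows "W1 A B \<le> D"
proof -
  interpret A: prob_space A using P1D(1)[OF A] .
  interpret B: prob_space B using P1D(1)[OF B] .
  note spA = P1D(3)[OF A] and spB = P1D(3)[OF B]
  define H :: "('a \<Rightarrow> real) \<Rightarrow> ('a \<Rightarrow> real) \<Rightarrow> real \<Rightarrow> 'a \<times> 'a \<Rightarrow> real"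
    where "H \<phi> \<psi> t = (\<lambda>p. \<phi> (fst p) + \<psi> (snd p) + t * dist (fst p) (snd p))" for \<phi> \<psi> t
  define R where "R \<phi> \<psi> t = (\<integral>x. \<phi> x \<partial>A) + (\<integral>y. \<psi> y \<partial>B) + t * D" for \<phi> \<psi> and t :: real
  define K where "K = {(H \<phi> \<psi> t, R \<phi> \<psi> t) | \<phi> \<psi> t. integrable A \<phi> \<and> integrable B \<psi> \<and> 0 \<le> t}"
  have K: "(h, r) \<in> K" if "integrable A \<phi>" "integrable B \<psi>" "0 \<le> t" "h = H \<phi> \<psi> t" "r = R \<phi> \<psi> t" for \<phi> \<psi> t h r
    using that unfolding K_def by blast
  have zero: "((\<lambda>p. 0), 0) \<in> K"
    by (rule K[of "\<lambda>_. 0" "\<lambda>_. 0" 0]) (simp_all add: H_def R_def)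
  have add: "((\<lambda>p. h p + h' p), r + r') \<in> K" if "(h, r) \<in> K" "(h', r') \<in> K" for h r h' r'
  proof -
    obtain \<phi> \<psi> t where 1: "integrable A \<phi>" "integrable B \<psi>" "0 \<le> t" "h = H \<phi> \<psi> t" "r = R \<phi> \<psi> t"
      using \<open>(h, r) \<in> K\<close> by (auto simp: K_def)
    obtain \<phi>' \<psi>' t' where 2: "integrable A \<phi>'" "integrable B \<psi>'" "0 \<le> t'" "h' = H \<phi>' \<psi>' t'" "r' = R \<phi>' \<psi>' t'"
      using \<open>(h', r') \<in> K\<close> by (auto simp: K_def)
    show ?thesis
      using 1 2 by (intro K[of "\<lambda>x. \<phi> x + \<phi>' x" "\<lambda>x. \<psi> x + \<psi>' x" "t + t'"])
        (auto simp: H_def R_def algebra_simps)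
  qed
  have scale: "((\<lambda>p. c * h p), c * r) \<in> K" if "(h, r) \<in> K" "c > 0" for h r c
  proof -
    obtain \<phi> \<psi> t where 1: "integrable A \<phi>" "integrable B \<psi>" "0 \<le> t" "h = H \<phi> \<psi> t" "r = R \<phi> \<psi> t"
      using \<open>(h, r) \<in> K\<close> by (auto simp: K_def)
    show ?thesis
      using 1 \<open>c > 0\<close> by (intro K[of "\<lambda>x. c * \<phi> x" "\<lambda>x. c * \<psi> x" "c * t"])
        (auto simp: H_def R_def algebra_simps)
  qed
  have consistent: "0 \<le> r" if "(h, r) \<in> K" "\<And>z. z \<in> UNIV \<Longrightarrow> 0 \<le> h z" for h r
  proof -
    obtain \<phi> \<psi> t where 1: "integrable A \<phi>" "integrable B \<psi>" "0 \<le> t" "h = H \<phi> \<psi> t" "r = R \<phi> \<psi> t"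
      using \<open>(h, r) \<in> K\<close> by (auto simp: K_def)
    have "0 \<le> \<phi> x + \<psi> y + t * dist x y" for x y using that(2)[of "(x, y)"] 1(4) by (simp add: H_def)
    then show ?thesis using Kantorovich_c_transform[OF A B D 1(1-3)] 1(5) by (simp add: R_def)
  qed
  define V where "V = {f. \<exists>(h, r)\<in>K. \<forall>z\<in>UNIV. \<bar>f z\<bar> \<le> h z}"
  note ex = monotone_functional_exists[OF zero add scale consistent V_def]
  have V: "fun_subspace V" by (rule conjunct1[OF ex])
  from conjunct2[OF ex] obtain L where LL: "linear_functional_on V L \<and>
      (\<forall>f\<in>V. \<forall>g\<in>V. (\<forall>z\<in>UNIV. f z \<le> g z) \<longrightarrow> L f \<le> L g) \<and>
      (\<forall>h r. (h, r) \<in> K \<longrightarrow> (\<forall>f\<in>V. (\<forall>z\<in>UNIV. f z \<le> h z) \<longrightarrow> L f \<le> r))" ..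
  note L = conjunct1[OF LL]
  note mono = conjunct1[OF conjunct2[OF LL], rule_format]
  note LK = conjunct2[OF conjunct2[OF LL], rule_format]
  have memV: "f \<in> V" if "\<And>p. \<bar>f p\<bar> \<le> c" for f c
  proof -
    have "((\<lambda>p. c), c) \<in> K"
      by (rule K[of "\<lambda>_. c" "\<lambda>_. 0" 0]) (simp_all add: H_def R_def A.prob_space)
    then have "\<exists>(h, r)\<in>K. \<forall>z\<in>UNIV. \<bar>f z\<bar> \<le> h z"
      by (rule bexI[rotated]) (simp add: that)
    then show ?thesis by (simp add: V_def)
  qed
  have "W1 A B \<le> D + e" if e: "e > 0" for e
  proof -
    \<comment> \<open>The quarter accounts for two quantization errors that enter twice each: once
      in the bound for \<open>L G\<close> and once when the plan is realised by a coupling.\<close>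
    obtain n where n: "(\<integral>x. dist x (s (nearest s n x)) \<partial>A) < e / 4"
      using quantization_error_small[of s A "e/4", OF dense A] e by auto
    obtain m where m: "(\<integral>x. dist x (s (nearest s m x)) \<partial>B) < e / 4"
      using quantization_error_small[of s B "e/4", OF dense B] e by auto
    define k where "k = nearest s n"
    define l where "l = nearest s m"
    have kl: "k x \<le> n" "l x \<le> m" for x by (simp_all add: k_def l_def nearest_le)
    have [measurable]: "k \<in> borel \<rightarrow>\<^sub>M count_space UNIV" "l \<in> borel \<rightarrow>\<^sub>M count_space UNIV"
      by (simp_all add: k_def l_def)
    define F :: "nat \<Rightarrow> nat \<Rightarrow> 'a \<times> 'a \<Rightarrow> real"
      where "F a b = (\<lambda>p. of_bool (k (fst p) = a) * of_bool (l (snd p) = b))" for a b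
    define \<pi> where "\<pi> a b = L (F a b)" for a b
    have FV: "F a b \<in> V" for a b by (rule memV[of _ 1]) (auto simp: F_def)
    have L0: "L (\<lambda>p. 0) = 0" by (rule linear_functional_on_zero[OF V L])
    have Lneg: "L (\<lambda>p. - f p) = - L f" if "f \<in> V" for f
      by (rule linear_functional_on_minus[OF L that])
    \<comment> \<open>The constraint for \<open>(\<phi>, \<psi>)\<close> bounds \<open>L f\<close>
      from above, the one for \<open>(- \<phi>, - \<psi>)\<close> from below.\<close>
    have marg: "L f = R \<phi> \<psi> 0" if "integrable A \<phi>" "integrable B \<psi>" "f = H \<phi> \<psi> 0" "f \<in> V" for f \<phi> \<psi>
    proof (rule antisym)
      show "L f \<le> R \<phi> \<psi> 0"
        by (rule LK[OF K[OF that(1,2) _ refl refl] that(4)]) (simp_all add: that(3))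
      have neg: "(\<lambda>p. - f p) \<in> V" using fun_subspaceD(3)[OF V that(4), of "-1"] by simp
      have "L (\<lambda>p. - f p) \<le> R (\<lambda>x. - \<phi> x) (\<lambda>x. - \<psi> x) 0"
        by (rule LK[OF K[OF _ _ _ refl refl] neg]) (simp_all add: that H_def)
      then show "R \<phi> \<psi> 0 \<le> L f" using Lneg[OF that(4)] by (simp add: R_def)
    qed
    have intA: "integrable A (\<lambda>x. of_bool (k x = a) :: real)" "(\<integral>x. of_bool (k x = a) \<partial>A) = measure A {x. k x = a}" for a
    proof -
      have *: "{x. k x = a} \<in> sets A" unfolding P1D(2)[OF A] by measurable
      have "(\<lambda>x. of_bool (k x = a) :: real) = indicator {x. k x = a}" by (auto simp: indicator_def)
      then show "integrable A (\<lambda>x. of_bool (k x = a) :: real)" "(\<integral>x. of_bool (k x = a) \<partial>A) = measure A {x. k x = a}"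
        using * by (simp_all add: A.emeasure_eq_measure spA)
    qed
    have intB: "integrable B (\<lambda>x. of_bool (l x = a) :: real)" "(\<integral>x. of_bool (l x = a) \<partial>B) = measure B {x. l x = a}" for a
    proof -
      have *: "{x. l x = a} \<in> sets B" unfolding P1D(2)[OF B] by measurable
      have "(\<lambda>x. of_bool (l x = a) :: real) = indicator {x. l x = a}" by (auto simp: indicator_def)
      then show "integrable B (\<lambda>x. of_bool (l x = a) :: real)" "(\<integral>x. of_bool (l x = a) \<partial>B) = measure B {x. l x = a}"
        using * by (simp_all add: B.emeasure_eq_measure spB)
    qed
    have nonneg: "0 \<le> \<pi> a b" for a b
      using mono[OF fun_subspaceD(1)[OF V] FV[of a b]] L0 by (simp add: \<pi>_def F_def)
    have supp: "\<pi> a b = 0" if "\<not> (a \<le> n \<and> b \<le> m)" for a b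
    proof -
      have "\<not> (k x = a \<and> l y = b)" for x y using that kl by blast
      then have "F a b = (\<lambda>p. 0)" by (intro ext) (auto simp: F_def)
      then show ?thesis using L0 by (simp add: \<pi>_def)
    qed
    have row: "(\<Sum>b\<le>m. \<pi> a b) = measure A {x. k x = a}" for a
    proof -
      \<comment> \<open>Since \<open>l\<close> takes exactly one value up to \<open>m\<close>,
        summing the cell indicators over \<open>b\<close> leaves a function of the first
        variable.\<close>
      have eq: "(\<lambda>p. \<Sum>b\<le>m. 1 * F a b p) = H (\<lambda>x. of_bool (k x = a)) (\<lambda>_. 0) 0"
      proof
        fix p :: "'a \<times> 'a"
        have "(\<Sum>b\<le>m. of_bool (l (snd p) = b) :: real) = 1" using kl by (simp add: of_bool_def)
        then show "(\<Sum>b\<le>m. 1 * F a b p) = H (\<lambda>x. of_bool (k x = a)) (\<lambda>_. 0) 0 p"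
          by (simp add: F_def H_def sum_distrib_left[symmetric])
      qed
      have sum: "(\<lambda>p. \<Sum>b\<le>m. 1 * F a b p) \<in> V" "L (\<lambda>p. \<Sum>b\<le>m. 1 * F a b p) = (\<Sum>b\<le>m. 1 * L (F a b))"
        using linear_functional_on_sum[OF V L, of "{..m}" "F a" "\<lambda>_. 1"] FV by blast+
      have "(\<Sum>b\<le>m. \<pi> a b) = L (\<lambda>p. \<Sum>b\<le>m. 1 * F a b p)" unfolding sum(2) by (simp add: \<pi>_def)
      also have "\<dots> = R (\<lambda>x. of_bool (k x = a)) (\<lambda>_. 0) 0"
        by (rule marg[OF _ _ eq sum(1)]) (simp_all add: intA)
      finally show ?thesis by (simp add: R_def intA)
    qed
    have col: "(\<Sum>a\<le>n. \<pi> a b) = measure B {x. l x = b}" for b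
    proof -
      have eq: "(\<lambda>p. \<Sum>a\<le>n. 1 * F a b p) = H (\<lambda>_. 0) (\<lambda>x. of_bool (l x = b)) 0"
      proof
        fix p :: "'a \<times> 'a"
        have "(\<Sum>a\<le>n. of_bool (k (fst p) = a) :: real) = 1" using kl by (simp add: of_bool_def)
        then show "(\<Sum>a\<le>n. 1 * F a b p) = H (\<lambda>_. 0) (\<lambda>x. of_bool (l x = b)) 0 p"
          by (simp add: F_def H_def sum_distrib_right[symmetric])
      qed
      have sum: "(\<lambda>p. \<Sum>a\<le>n. 1 * F a b p) \<in> V" "L (\<lambda>p. \<Sum>a\<le>n. 1 * F a b p) = (\<Sum>a\<le>n. 1 * L (F a b))"
        using linear_functional_on_sum[OF V L, of "{..n}" "\<lambda>a. F a b" "\<lambda>_. 1"] FV by blast+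
      have "(\<Sum>a\<le>n. \<pi> a b) = L (\<lambda>p. \<Sum>a\<le>n. 1 * F a b p)" unfolding sum(2) by (simp add: \<pi>_def)
      also have "\<dots> = R (\<lambda>_. 0) (\<lambda>x. of_bool (l x = b)) 0"
        by (rule marg[OF _ _ eq sum(1)]) (simp_all add: intB)
      finally show ?thesis by (simp add: R_def intB)
    qed
    have iA: "integrable A (\<lambda>x. dist x (s (k x)))" unfolding k_def by (rule integrable_dist_nearest[OF A])
    have iB: "integrable B (\<lambda>x. dist x (s (l x)))" unfolding l_def by (rule integrable_dist_nearest[OF B])
    \<comment> \<open>\<open>G\<close> is the cost between cell representatives, written as a finite
      combination of cell indicators so that \<open>L G\<close> is the discrete transport
      cost.\<close>
    define G where "G = (\<lambda>p. \<Sum>q\<in>{..n}\<times>{..m}. dist (s (fst q)) (s (snd q)) * F (fst q) (snd q) p)"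
    have G: "G \<in> V" "L G = (\<Sum>q\<in>{..n}\<times>{..m}. dist (s (fst q)) (s (snd q)) * \<pi> (fst q) (snd q))"
      using linear_functional_on_sum[OF V L, of "{..n}\<times>{..m}" "\<lambda>q. F (fst q) (snd q)" "\<lambda>q. dist (s (fst q)) (s (snd q))"] FV
      by (simp_all add: G_def \<pi>_def)
    have Gp: "G p = dist (s (k (fst p))) (s (l (snd p)))" for p
    proof -
      have "G p = (\<Sum>q\<in>{..n}\<times>{..m}. if q = (k (fst p), l (snd p)) then dist (s (k (fst p))) (s (l (snd p))) else 0)"
        unfolding G_def by (intro sum.cong) (auto simp: F_def)
      then show ?thesis using kl by simp
    qed
    have "L G \<le> R (\<lambda>x. dist x (s (k x))) (\<lambda>y. dist y (s (l y))) 1"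
    proof (rule LK[OF K[OF iA iB _ refl refl] G(1)])
      fix p :: "'a \<times> 'a"
      show "G p \<le> H (\<lambda>x. dist x (s (k x))) (\<lambda>y. dist y (s (l y))) 1 p"
        using dist_triangle[of "s (k (fst p))" "s (l (snd p))" "fst p"] dist_triangle[of "fst p" "s (l (snd p))" "snd p"]
        by (simp add: Gp H_def dist_commute)
    qed simp
    also have "\<dots> \<le> e/4 + e/4 + D" using n m by (simp add: R_def k_def l_def)
    finally have "(\<Sum>a\<le>n. \<Sum>b\<le>m. \<pi> a b * dist (s a) (s b)) \<le> e/4 + e/4 + D"
      by (simp add: G(2) sum.cartesian_product case_prod_unfold mult.commute)
    moreover have "W1 A B \<le> (\<integral>x. dist x (s (k x)) \<partial>A) + (\<Sum>a\<le>n. \<Sum>b\<le>m. \<pi> a b * dist (s a) (s b))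
        + (\<integral>x. dist x (s (l x)) \<partial>B)"
      by (rule W1_le_cell_plan[OF dense A B _ kl(1) iA _ kl(2) iB nonneg row col supp]) auto
    ultimately show ?thesis using n m by (simp add: k_def l_def)
  qed
  then show ?thesis by (rule field_le_epsilon)
qed

text \<open>Integrating \<open>f x - f y \<le> dist x y\<close> against a coupling bounds the
  difference of integrals by the cost. The product coupling has finite cost, so
  \<open>enn2real\<close> does not collapse an infinite infimum to 0.\<close>

lemma Kantorovich_Rubinstein_ge:
  fixes A B :: "'a::metric_space measure" and s :: "nat \<Rightarrow> 'a"
  assumes dense: "\<And>x e. e > 0 \<Longrightarrow> \<exists>n. dist x (s n) < e"
    and A: "P1 A" and B: "P1 B" and f: "1-lipschitz_on UNIV f"
  shows "(\<integral>x. f x \<partial>A) - (\<integral>x. f x \<partial>B) \<le> W1 A B"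
proof -
  interpret A: prob_space A using P1D(1)[OF A] .
  interpret B: prob_space B using P1D(1)[OF B] .
  interpret AB: pair_prob_space A B ..
  note [measurable_cong] = P1D(2)[OF A] P1D(2)[OF B]
  note [measurable] = measurable_dist_pair_borel[OF dense] lipschitz_borel_measurable[OF f]
  define I where "I = (\<Sqinter>\<pi>\<in>couplings A B. \<integral>\<^sup>+ p. ennreal (dist (fst p) (snd p)) \<partial>\<pi>)"
  have lower: "ennreal ((\<integral>x. f x \<partial>A) - (\<integral>x. f x \<partial>B)) \<le> (\<integral>\<^sup>+ p. ennreal (dist (fst p) (snd p)) \<partial>P)"
    if P: "P \<in> couplings A B" for P
  proof (cases "(\<integral>\<^sup>+ p. ennreal (dist (fst p) (snd p)) \<partial>P) = \<infinity>")
    case False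
    have [measurable_cong]: "sets P = sets (borel \<Otimes>\<^sub>M borel)" and d: "distr P borel fst = A" "distr P borel snd = B"
      using P by (auto simp: couplings_def)
    have int: "integrable P (\<lambda>p. dist (fst p) (snd p))"
      using False by (intro integrableI_nonneg) (auto simp: top.not_eq_extremum)
    have f1: "integrable P (\<lambda>p. f (fst p))" "(\<integral>p. f (fst p) \<partial>P) = (\<integral>x. f x \<partial>A)"
      using integrable_lipschitz_P1[OF A f] unfolding d(1)[symmetric]
      by (simp_all add: integrable_distr_eq integral_distr)
    have f2: "integrable P (\<lambda>p. f (snd p))" "(\<integral>p. f (snd p) \<partial>P) = (\<integral>x. f x \<partial>B)"
      using integrable_lipschitz_P1[OF B f] unfolding d(2)[symmetric]
      by (simp_all add: integrable_distr_eq integral_distr)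
    have "(\<integral>x. f x \<partial>A) - (\<integral>x. f x \<partial>B) = (\<integral>p. f (fst p) - f (snd p) \<partial>P)"
      using f1 f2 by simp
    also have "\<dots> \<le> (\<integral>p. dist (fst p) (snd p) \<partial>P)"
      using f1 f2 int lipschitz_1_abs_le[OF f] by (intro integral_mono) (auto simp: abs_le_iff)
    finally have "ennreal ((\<integral>x. f x \<partial>A) - (\<integral>x. f x \<partial>B)) \<le> ennreal (\<integral>p. dist (fst p) (snd p) \<partial>P)"
      by (rule ennreal_leI)
    also have "\<dots> = (\<integral>\<^sup>+ p. ennreal (dist (fst p) (snd p)) \<partial>P)"
      using int by (simp add: nn_integral_eq_integral)
    finally show ?thesis .
  qed simp
  have "A \<Otimes>\<^sub>M B \<in> couplings A B"
  proof -
    have "distr (A \<Otimes>\<^sub>M B) borel fst = distr (A \<Otimes>\<^sub>M B) A fst" "distr (A \<Otimes>\<^sub>M B) borel snd = distr (A \<Otimes>\<^sub>M B) B snd"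
      by (intro distr_cong; simp add: P1D(2)[OF A] P1D(2)[OF B])+
    moreover have "distr (A \<Otimes>\<^sub>M B) A fst = A" by (rule B.distr_pair_fst)
    moreover have "distr (A \<Otimes>\<^sub>M B) B snd = B"
    proof (rule measure_eqI)
      fix E assume "E \<in> sets (distr (A \<Otimes>\<^sub>M B) B snd)"
      then have E: "E \<in> sets B" by simp
      have "snd -` E \<inter> space (A \<Otimes>\<^sub>M B) = space A \<times> E"
        using sets.sets_into_space[OF E] by (auto simp: space_pair_measure)
      then show "emeasure (distr (A \<Otimes>\<^sub>M B) B snd) E = emeasure B E"
        using E by (simp add: emeasure_distr B.emeasure_pair_measure_Times A.emeasure_space_1)
    qed simp
    moreover have "sets (A \<Otimes>\<^sub>M B) = sets (borel \<Otimes>\<^sub>M borel)"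
      by (intro sets_pair_measure_cong P1D(2)[OF A] P1D(2)[OF B])
    ultimately show ?thesis
      using AB.prob_space_axioms by (simp add: couplings_def)
  qed
  moreover have "(\<integral>\<^sup>+ p. ennreal (dist (fst p) (snd p)) \<partial>(A \<Otimes>\<^sub>M B)) < \<infinity>"
  proof -
    fix x0 :: 'a
    have "(\<integral>\<^sup>+ p. ennreal (dist (fst p) (snd p)) \<partial>(A \<Otimes>\<^sub>M B)) \<le> (\<integral>\<^sup>+ p. ennreal (dist (fst p) x0) + ennreal (dist x0 (snd p)) \<partial>(A \<Otimes>\<^sub>M B))"
      by (intro nn_integral_mono) (simp add: dist_triangle ennreal_plus[symmetric] del: ennreal_plus)
    also have "\<dots> = (\<integral>\<^sup>+ x. \<integral>\<^sup>+ y. ennreal (dist x x0) + ennreal (dist y x0) \<partial>B \<partial>A)"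
      by (subst B.nn_integral_fst[symmetric]) (simp_all add: dist_commute[of x0])
    also have "\<dots> = (\<integral>\<^sup>+ x. ennreal (dist x x0) \<partial>A) + (\<integral>\<^sup>+ y. ennreal (dist y x0) \<partial>B)"
      by (simp add: nn_integral_add A.emeasure_space_1 B.emeasure_space_1)
    also have "\<dots> < \<infinity>" using P1D(5)[OF A, of x0] P1D(5)[OF B, of x0] by (simp add: nn_integral_eq_integral)
    finally show ?thesis .
  qed
  ultimately have "I < \<infinity>" unfolding I_def by (meson INF_lower le_less_trans)
  moreover have "ennreal ((\<integral>x. f x \<partial>A) - (\<integral>x. f x \<partial>B)) \<le> I"
    unfolding I_def by (rule INF_greatest) (rule lower)
  \<comment> \<open>A negative difference is truncated to 0 by \<open>ennreal\<close>; that case is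
    settled by nonnegativity of \<open>W1\<close> at the end.\<close>
  ultimately have "enn2real (ennreal ((\<integral>x. f x \<partial>A) - (\<integral>x. f x \<partial>B))) \<le> W1 A B"
    unfolding W1_def I_def[symmetric] by (intro enn2real_mono) simp_all
  moreover have "0 \<le> W1 A B" by (simp add: W1_def)
  ultimately show ?thesis
    by (cases "0 \<le> (\<integral>x. f x \<partial>A) - (\<integral>x. f x \<partial>B)") simp_all
qed

section \<open>Wasserstein medians\<close>

text \<open>The mixture arises by choosing \<open>A\<close> or \<open>B\<close> with a Bernoulli
  variable of parameter \<open>u\<close> and then sampling. It expresses convexity of the set of
  competitors, needed to add constraints in the minimax argument.\<close>

lemma P1_mixture:
  fixes A B :: "'a::metric_space measure" and u :: real
  assumes A: "P1 A" and B: "P1 B" and u: "0 \<le> u" "u \<le> 1"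
  shows "\<exists>C. P1 C \<and> (\<forall>f. 1-lipschitz_on UNIV f \<longrightarrow> (\<integral>x. f x \<partial>C) = u * (\<integral>x. f x \<partial>A) + (1 - u) * (\<integral>x. f x \<partial>B))"
proof -
  interpret A: prob_space A using P1D(1)[OF A] .
  interpret B: prob_space B using P1D(1)[OF B] .
  define N where "N b = (if b then A else B)" for b
  have "N b \<in> space (subprob_algebra borel)" for b
    using P1D(2)[OF A] P1D(2)[OF B] A.prob_space_axioms B.prob_space_axioms
    by (auto simp: N_def space_subprob_algebra intro: prob_space_imp_subprob_space)
  then have N: "N \<in> measure_pmf (bernoulli_pmf u) \<rightarrow>\<^sub>M subprob_algebra borel"
    by (auto simp: measurable_def)
  define C where "C = measure_pmf (bernoulli_pmf u) \<bind> N"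
  have sets_C[measurable_cong]: "sets C = sets borel" unfolding C_def
    by (rule sets_bind[where N = borel]) (auto simp: N_def P1D(2)[OF A] P1D(2)[OF B])
  have nn: "(\<integral>\<^sup>+x. f x \<partial>C) = ennreal u * (\<integral>\<^sup>+x. f x \<partial>A) + ennreal (1 - u) * (\<integral>\<^sup>+x. f x \<partial>B)"
    if "f \<in> borel_measurable borel" for f
    unfolding C_def by (subst nn_integral_bind[OF that N]) (simp add: N_def u mult.commute)
  have "prob_space C"
  proof (rule prob_spaceI)
    show "emeasure C (space C) = 1"
      using nn[of "\<lambda>_. 1"] u A.emeasure_space_1 B.emeasure_space_1
      by (simp add: ennreal_plus[symmetric] del: ennreal_plus)
  qed
  have fin: "(\<integral>\<^sup>+x. ennreal (f x) \<partial>M) < \<infinity>" if "integrable M f" for M :: "'a measure" and f :: "'a \<Rightarrow> real"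
  proof -
    have "(\<integral>\<^sup>+x. ennreal (f x) \<partial>M) \<le> (\<integral>\<^sup>+x. ennreal (norm (f x)) \<partial>M)"
      by (intro nn_integral_mono ennreal_leI) simp
    then show ?thesis using that by (auto simp: integrable_iff_bounded intro: le_less_trans)
  qed
  have "integrable C (\<lambda>y. dist x0 y)" for x0
  proof (rule integrableI_nonneg)
    show "(\<lambda>y. dist x0 y) \<in> borel_measurable C"
      unfolding dist_commute[of x0] by measurable
    show "(\<integral>\<^sup>+y. ennreal (dist x0 y) \<partial>C) < \<infinity>"
      using fin[OF P1D(4)[OF A, of x0]] fin[OF P1D(4)[OF B, of x0]]
      unfolding dist_commute[of x0] by (subst nn) (auto simp: ennreal_mult_less_top)
  qed simp
  then have C: "P1 C" using \<open>prob_space C\<close> sets_C by (auto simp: P1_def)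
  moreover have "(\<integral>x. f x \<partial>C) = u * (\<integral>x. f x \<partial>A) + (1 - u) * (\<integral>x. f x \<partial>B)" if f: "1-lipschitz_on UNIV f" for f
  proof -
    note fm[measurable] = lipschitz_borel_measurable[OF f]
    \<comment> \<open>Here \<open>ennreal\<close> keeps only the positive part of \<open>g\<close>;
      the choices \<open>f\<close> and \<open>- f\<close> recover the signed integral.\<close>
    have "enn2real (\<integral>\<^sup>+x. ennreal (g x) \<partial>C) = u * enn2real (\<integral>\<^sup>+x. ennreal (g x) \<partial>A) + (1 - u) * enn2real (\<integral>\<^sup>+x. ennreal (g x) \<partial>B)"
      if [measurable]: "g \<in> borel_measurable borel" and g: "integrable A g" "integrable B g" for g :: "'a \<Rightarrow> real"
      using fin[OF g(1)] fin[OF g(2)] u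
      by (subst nn, measurable) (simp add: enn2real_plus enn2real_mult ennreal_mult_less_top)
    from this[of f] this[of "\<lambda>x. - f x"] show ?thesis
      using integrable_lipschitz_P1[OF A f] integrable_lipschitz_P1[OF B f] integrable_lipschitz_P1[OF C f]
      by (simp add: real_lebesgue_integral_def algebra_simps)
  qed
  ultimately show ?thesis by blast
qed

lemma P1_return: "P1 (return borel (y :: 'a::metric_space))"
proof -
  interpret prob_space "return borel y" by (rule prob_space_return) simp
  have "integrable (return borel y) (\<lambda>x. dist x y)"
    by (intro integrableI_nonneg) (auto simp: nn_integral_return)
  then have "integrable (return borel y) (\<lambda>x. dist y x)" by (subst dist_commute)
  then show ?thesis using prob_space_axioms by (auto simp: P1_def)
qed

text \<open>The complement of the support is covered by those balls with centre \<open>s n\<close>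
  and radius \<open>1 / (m + 1)\<close> that are null, and there are countably many of them.\<close>

lemma AE_spt:
  fixes M :: "'a::metric_space measure" and s :: "nat \<Rightarrow> 'a"
  assumes dense: "\<And>x e. e > 0 \<Longrightarrow> \<exists>n. dist x (s n) < e" and M: "P1 M"
  shows "AE x in M. x \<in> spt M"
proof -
  define b where "b n m = ball (s n) (1 / real (Suc m))" for n m
  define X where "X = (\<Union>p\<in>{p. emeasure M (b (fst p) (snd p)) = 0}. b (fst p) (snd p))"
  have "X \<in> null_sets M"
    unfolding X_def
    by (rule null_sets_UN') (auto simp: b_def P1D(2)[OF M] intro!: null_setsI)
  moreover have "{x \<in> space M. x \<notin> spt M} \<subseteq> X"
  proof safe
    fix x assume "x \<notin> spt M"
    then obtain U where U: "open U" "x \<in> U" "emeasure M U = 0" by (auto simp: spt_def)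
    obtain r where r: "r > 0" "ball x r \<subseteq> U" using openE[OF U(1,2)] by blast
    \<comment> \<open>With radius below \<open>r / 2\<close>, a ball containing \<open>x\<close> has
      diameter less than \<open>r\<close> and stays inside \<open>U\<close>.\<close>
    obtain m where m: "1 / real (Suc m) < r / 2" using nat_approx_posE[of "r / 2"] r(1) by auto
    obtain n where n: "dist x (s n) < 1 / real (Suc m)" using dense[of "1 / real (Suc m)" x] by auto
    have "b n m \<subseteq> U"
    proof
      fix y assume "y \<in> b n m"
      then have "dist x y < r" using dist_triangle[of x y "s n"] n m by (simp add: b_def)
      then show "y \<in> U" using r(2) by auto
    qed
    then have "emeasure M (b n m) \<le> emeasure M U"
      using U(1) by (intro emeasure_mono) (simp_all add: P1D(2)[OF M])
    then have "emeasure M (b n m) = 0" using U(3) by simp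
    moreover have "x \<in> b n m" using n by (simp add: b_def dist_commute)
    ultimately show "x \<in> X" by (auto simp: X_def)
  qed
  ultimately show ?thesis by (rule AE_I')
qed

text \<open>Moving \<open>x\<close> to its nearest sample point changes \<open>f\<close> by at most
  the distance moved. An integral is thus a finite combination of point values up to an error that
  is the same for all 1-Lipschitz \<open>f\<close>.\<close>

lemma integral_cell_approx:
  fixes M :: "'a::metric_space measure" and s :: "nat \<Rightarrow> 'a" and f :: "'a \<Rightarrow> real"
  assumes M: "P1 M" and f: "1-lipschitz_on UNIV f"
  shows "\<bar>(\<integral>x. f x \<partial>M) - (\<Sum>a\<le>n. measure M {x. nearest s n x = a} * f (s a))\<bar> \<le> (\<integral>x. dist x (s (nearest s n x)) \<partial>M)"
proof -
  interpret prob_space M using P1D(1)[OF M] .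
  note sp = P1D(3)[OF M]
  define k where "k = nearest s n"
  have kn: "k x \<le> n" for x by (simp add: k_def nearest_le)
  have ck: "{x. k x = a} \<in> sets M" for a
    using measurable_sets[OF P1_measurable_borel[OF M nearest_measurable[of s n]], of "{a}"]
    by (simp add: k_def sp vimage_def)
  have eq: "f (s (k x)) = (\<Sum>a\<le>n. indicator {x. k x = a} x * f (s a))" for x
  proof -
    have "(\<Sum>a\<le>n. indicator {x. k x = a} x * f (s a)) = (\<Sum>a\<le>n. if a = k x then f (s a) else 0)"
      by (intro sum.cong) (auto simp: indicator_def)
    then show ?thesis using kn by simp
  qed
  have int: "integrable M (\<lambda>x. f (s (k x)))"
    unfolding eq using ck by (intro Bochner_Integration.integrable_sum integrable_mult_left) (simp add: emeasure_eq_measure)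
  have "(\<integral>x. f (s (k x)) \<partial>M) = (\<Sum>a\<le>n. measure M {x. k x = a} * f (s a))"
    unfolding eq using ck by (subst Bochner_Integration.integral_sum) (simp_all add: emeasure_eq_measure sp)
  then have "(\<integral>x. f x \<partial>M) - (\<Sum>a\<le>n. measure M {x. k x = a} * f (s a)) = (\<integral>x. f x - f (s (k x)) \<partial>M)"
    using integrable_lipschitz_P1[OF M f] int by simp
  also have "\<bar>\<dots>\<bar> \<le> (\<integral>x. \<bar>f x - f (s (k x))\<bar> \<partial>M)" by (rule integral_abs_bound)
  also have "\<dots> \<le> (\<integral>x. dist x (s (k x)) \<partial>M)"
    using integrable_lipschitz_P1[OF M f] int integrable_dist_nearest[OF M, of s n] lipschitz_1_abs_le[OF f]
    by (intro integral_mono) (simp_all add: k_def)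
  finally show ?thesis by (simp add: k_def)
qed

text \<open>By continuity the set where \<open>u < 0\<close> is open, and it is null because the
  integral vanishes; such a set contains no point of the support.\<close>

lemma nonpos_integral_eq_0_imp_zero_on_spt:
  fixes M :: "'a::metric_space measure" and u :: "'a \<Rightarrow> real"
  assumes M: "P1 M" and u: "integrable M u" "continuous_on UNIV u" "\<And>x. u x \<le> 0"
    and int: "(\<integral>x. u x \<partial>M) = 0" and x: "x \<in> spt M"
  shows "u x = 0"
proof (rule ccontr)
  assume "u x \<noteq> 0"
  have op: "open {x. u x < 0}" using open_Collect_less[OF u(2) continuous_on_const] .
  have "AE y in M. - u y = 0"
    using integral_nonneg_eq_0_iff_AE[of M "\<lambda>y. - u y"] u int by auto
  then have "AE y in M. y \<notin> {x. u x < 0}" by auto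
  then have "emeasure M {x. u x < 0} = 0"
    using AE_iff_measurable[of "{x. u x < 0}" M "\<lambda>y. y \<notin> {x. u x < 0}"] op by (auto simp: P1D(2,3)[OF M])
  moreover have "x \<in> {x. u x < 0}" using u(3)[of x] \<open>u x \<noteq> 0\<close> by simp
  ultimately show False using x op by (auto simp: spt_def)
qed

lemma integral_sum_lipschitz:
  fixes \<psi> :: "nat \<Rightarrow> 'a::metric_space \<Rightarrow> real"
  assumes M: "P1 M" and \<psi>: "\<And>i. i < N \<Longrightarrow> 1-lipschitz_on UNIV (\<psi> i)"
  shows "integrable M (\<lambda>x. \<Sum>i<N. lam i * \<psi> i x)"
    "(\<integral>x. (\<Sum>i<N. lam i * \<psi> i x) \<partial>M) = (\<Sum>i<N. lam i * (\<integral>x. \<psi> i x \<partial>M))"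
proof -
  have int: "i < N \<Longrightarrow> integrable M (\<lambda>x. lam i * \<psi> i x)" for i
    using integrable_lipschitz_P1[OF M \<psi>] by simp
  show "integrable M (\<lambda>x. \<Sum>i<N. lam i * \<psi> i x)"
    by (rule Bochner_Integration.integrable_sum, rule int) simp
  have "(\<integral>x. (\<Sum>i<N. lam i * \<psi> i x) \<partial>M) = (\<Sum>i<N. \<integral>x. lam i * \<psi> i x \<partial>M)"
    by (rule Bochner_Integration.integral_sum, rule int) simp
  then show "(\<integral>x. (\<Sum>i<N. lam i * \<psi> i x) \<partial>M) = (\<Sum>i<N. lam i * (\<integral>x. \<psi> i x \<partial>M))" by simp
qed

section \<open>Potentials and medians: sufficiency, then necessity\<close>

text \<open>The weighted sum of potentials integrates to 0 against \<mu>, whose support has full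
  measure, and to at most 0 against a competitor. Replacing \<mu> by the competitor thus does not
  lower the dual expression, which \<open>Kantorovich_Rubinstein_ge\<close> bounds by the
  competitor's objective.\<close>

lemma Med_if_potentials:
  fixes nu :: "nat \<Rightarrow> 'a::metric_space measure" and s :: "nat \<Rightarrow> 'a"
  assumes dense: "\<And>x e. e > 0 \<Longrightarrow> \<exists>n. dist x (s n) < e"
    and nu: "\<And>i. i < N \<Longrightarrow> P1 (nu i)" and lam: "\<And>i. i < N \<Longrightarrow> lam i > 0" and mu: "P1 \<mu>"
    and \<psi>: "\<And>i. i < N \<Longrightarrow> 1-lipschitz_on UNIV (\<psi> i)"
    and opt: "\<And>i. i < N \<Longrightarrow> W1 (nu i) \<mu> = (\<integral>x. \<psi> i x \<partial>nu i) - (\<integral>x. \<psi> i x \<partial>\<mu>)"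
    and le: "\<And>x. (\<Sum>i<N. lam i * \<psi> i x) \<le> 0"
    and eq: "\<And>x. x \<in> spt \<mu> \<Longrightarrow> (\<Sum>i<N. lam i * \<psi> i x) = 0"
  shows "\<mu> \<in> Med N lam nu"
proof -
  have "(\<Sum>i<N. lam i * W1 (nu i) \<mu>) \<le> (\<Sum>i<N. lam i * W1 (nu i) \<mu>')" if mu': "P1 \<mu>'" for \<mu>'
  proof -
    have "AE x in \<mu>. x \<in> spt \<mu>" by (rule AE_spt[OF dense mu])
    then have "AE x in \<mu>. (\<Sum>i<N. lam i * \<psi> i x) = 0" by eventually_elim (rule eq)
    then have "(\<integral>x. (\<Sum>i<N. lam i * \<psi> i x) \<partial>\<mu>) = 0" by (rule integral_eq_zero_AE)
    then have 0: "(\<Sum>i<N. lam i * (\<integral>x. \<psi> i x \<partial>\<mu>)) = 0"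
      using integral_sum_lipschitz(2)[where N = N and lam = lam, OF mu \<psi>] by simp
    have "(\<integral>x. (\<Sum>i<N. lam i * \<psi> i x) \<partial>\<mu>') \<le> (\<integral>x. 0 \<partial>\<mu>')"
      by (rule integral_mono[OF integral_sum_lipschitz(1)[OF mu' \<psi>]]) (simp_all add: le)
    then have 1: "(\<Sum>i<N. lam i * (\<integral>x. \<psi> i x \<partial>\<mu>')) \<le> 0"
      using integral_sum_lipschitz(2)[where N = N and lam = lam, OF mu' \<psi>] by simp
    have "(\<Sum>i<N. lam i * W1 (nu i) \<mu>) = (\<Sum>i<N. lam i * (\<integral>x. \<psi> i x \<partial>nu i) - lam i * (\<integral>x. \<psi> i x \<partial>\<mu>))"
      by (intro sum.cong) (auto simp: opt algebra_simps)
    also have "\<dots> = (\<Sum>i<N. lam i * (\<integral>x. \<psi> i x \<partial>nu i))" using 0 by (simp add: sum_subtractf)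
    also have "\<dots> \<le> (\<Sum>i<N. lam i * (\<integral>x. \<psi> i x \<partial>nu i) - lam i * (\<integral>x. \<psi> i x \<partial>\<mu>'))"
      using 1 by (simp add: sum_subtractf)
    also have "\<dots> \<le> (\<Sum>i<N. lam i * W1 (nu i) \<mu>')"
    proof (rule sum_mono)
      fix i assume "i \<in> {..<N}"
      then have "(\<integral>x. \<psi> i x \<partial>nu i) - (\<integral>x. \<psi> i x \<partial>\<mu>') \<le> W1 (nu i) \<mu>'" "0 \<le> lam i"
        using Kantorovich_Rubinstein_ge[OF dense nu mu' \<psi>, of i] lam[of i] by auto
      then have "lam i * ((\<integral>x. \<psi> i x \<partial>nu i) - (\<integral>x. \<psi> i x \<partial>\<mu>')) \<le> lam i * W1 (nu i) \<mu>'"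
        by (rule mult_left_mono)
      then show "lam i * (\<integral>x. \<psi> i x \<partial>nu i) - lam i * (\<integral>x. \<psi> i x \<partial>\<mu>') \<le> lam i * W1 (nu i) \<mu>'"
        by (simp add: algebra_simps)
    qed
    finally show ?thesis .
  qed
  then show ?thesis using mu by (simp add: Med_def)
qed

text \<open>A minimax argument: a mean \<open>L\<close> over all tuples of normalised 1-Lipschitz functions is
  chosen so that it cannot be improved by any competitor \<open>\<mu>'\<close>, and \<open>\<psi> i\<close> is its barycentre.\<close>
lemma Med_potentials_saddle:
  fixes nu :: "nat \<Rightarrow> 'a::metric_space measure" and s :: "nat \<Rightarrow> 'a"
  assumes dense: "\<And>x e. e > 0 \<Longrightarrow> \<exists>n. dist x (s n) < e"
    and nu: "\<And>i. i < N \<Longrightarrow> P1 (nu i)" and lam: "\<And>i. i < N \<Longrightarrow> lam i > 0"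
    and lam_sum: "(\<Sum>i<N. lam i) = 1" and med: "\<mu> \<in> Med N lam nu"
  shows "\<exists>\<psi>. (\<forall>i<N. 1-lipschitz_on UNIV (\<psi> i)) \<and> (\<forall>\<mu>'. P1 \<mu>' \<longrightarrow>
    (\<Sum>i<N. lam i * W1 (nu i) \<mu>) \<le> (\<Sum>i<N. lam i * ((\<integral>x. \<psi> i x \<partial>nu i) - (\<integral>x. \<psi> i x \<partial>\<mu>'))))"
proof -
  fix x0 :: 'a
  define D where "D = (\<Sum>i<N. lam i * W1 (nu i) \<mu>)"
  have mu: "P1 \<mu>" and minimal: "\<And>\<mu>'. P1 \<mu>' \<Longrightarrow> D \<le> (\<Sum>i<N. lam i * W1 (nu i) \<mu>')"
    using med by (auto simp: Med_def D_def)
  \<comment> \<open>Vanishing at \<open>x0\<close> bounds evaluations by \<open>dist x x0\<close>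
    and integrals by first moments, so both lie in the domain of the mean. The objective
    \<open>\<Phi>\<close> at measures in \<open>P1\<close> sees potentials only up to
    constants.\<close>
  define Z :: "(nat \<Rightarrow> 'a \<Rightarrow> real) set" where "Z = {\<Psi>. \<forall>i<N. 1-lipschitz_on UNIV (\<Psi> i) \<and> \<Psi> i x0 = 0}"
  define \<Phi> where "\<Phi> \<mu>' \<Psi> = (\<Sum>i<N. lam i * ((\<integral>x. \<Psi> i x \<partial>nu i) - (\<integral>x. \<Psi> i x \<partial>\<mu>')))" for \<mu>' and \<Psi> :: "nat \<Rightarrow> 'a \<Rightarrow> real"
  \<comment> \<open>For \<open>c = 0\<close> and \<open>t = 1\<close> the constraint says
    \<open>L (\<Phi> \<mu>') \<ge> D\<close>; for \<open>t = 0\<close> it normalises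
    \<open>L\<close> on constants.\<close>
  define K where "K = {(h, c). \<exists>t \<mu>'. 0 \<le> t \<and> P1 \<mu>' \<and> (\<forall>\<Psi>\<in>Z. h \<Psi> = c - t * (\<Phi> \<mu>' \<Psi> - D))}"
  have K: "(h, c) \<in> K" if "0 \<le> t" "P1 \<mu>'" "\<And>\<Psi>. \<Psi> \<in> Z \<Longrightarrow> h \<Psi> = c - t * (\<Phi> \<mu>' \<Psi> - D)" for h c t \<mu>'
    using that unfolding K_def by blast
  have ZD: "1-lipschitz_on UNIV (\<Psi> i)" "\<Psi> i x0 = 0" if "\<Psi> \<in> Z" "i < N" for \<Psi> i
    using that by (auto simp: Z_def)
  have Z0: "(\<lambda>_ _. 0) \<in> Z" by (simp add: Z_def lipschitz_1I)
  have sup_ge: "\<exists>\<Psi>\<in>Z. D - e < \<Phi> \<mu>' \<Psi>" if mu': "P1 \<mu>'" and e: "e > 0" for \<mu>' e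
  proof -
    have "\<exists>f. 1-lipschitz_on UNIV f \<and> W1 (nu i) \<mu>' - e < (\<integral>x. f x \<partial>nu i) - (\<integral>x. f x \<partial>\<mu>')" if i: "i < N" for i
    proof (rule ccontr)
      assume "\<not> ?thesis"
      then have "W1 (nu i) \<mu>' \<le> W1 (nu i) \<mu>' - e"
        by (intro Kantorovich_Rubinstein_le[OF dense nu[OF i] mu']) (auto simp: not_less)
      then show False using e by simp
    qed
    then obtain f where f: "\<And>i. i < N \<Longrightarrow> 1-lipschitz_on UNIV (f i)"
        "\<And>i. i < N \<Longrightarrow> W1 (nu i) \<mu>' - e < (\<integral>x. f i x \<partial>nu i) - (\<integral>x. f i x \<partial>\<mu>')"
      by metis
    define \<Psi> where "\<Psi> i x = f i x - f i x0" for i x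
    have "\<Psi> \<in> Z"
      using lipschitz_1_abs_le[OF f(1)] by (auto simp: Z_def \<Psi>_def abs_le_iff intro!: lipschitz_1I)
    have int: "(\<integral>x. \<Psi> i x \<partial>M) = (\<integral>x. f i x \<partial>M) - f i x0" if "i < N" "P1 M" for i M
      using integrable_lipschitz_P1[OF that(2) f(1)[OF that(1)]] prob_space.prob_space[OF P1D(1)[OF that(2)]]
        prob_space.finite_measure[OF P1D(1)[OF that(2)]]
      by (simp add: \<Psi>_def finite_measure.integrable_const)
    \<comment> \<open>A loss of \<open>e\<close> in each potential averages to a loss of
      \<open>e\<close> since the weights sum to 1; a nonempty index set keeps the inequality
      strict.\<close>
    have "N \<noteq> 0" using lam_sum by (cases N) auto
    have "D - e \<le> (\<Sum>i<N. lam i * W1 (nu i) \<mu>') - (\<Sum>i<N. lam i * e)"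
      using minimal[OF mu'] lam_sum by (simp add: sum_distrib_right[symmetric])
    also have "\<dots> = (\<Sum>i<N. lam i * (W1 (nu i) \<mu>' - e))" by (simp add: sum_subtractf algebra_simps)
    also have "\<dots> < \<Phi> \<mu>' \<Psi>"
      unfolding \<Phi>_def
    proof (rule sum_strict_mono)
      fix i assume i: "i \<in> {..<N}"
      then show "lam i * (W1 (nu i) \<mu>' - e) < lam i * ((\<integral>x. \<Psi> i x \<partial>nu i) - (\<integral>x. \<Psi> i x \<partial>\<mu>'))"
        using f(2)[of i] lam[of i] by (simp add: int mu' nu)
    qed (use \<open>N \<noteq> 0\<close> in auto)
    finally show ?thesis using \<open>\<Psi> \<in> Z\<close> by blast
  qed
  have zero: "((\<lambda>_. 0), 0) \<in> K" by (rule K[of 0, OF _ mu]) simp_all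
  have add: "((\<lambda>z. h z + h' z), c + c') \<in> K" if hc: "(h, c) \<in> K" "(h', c') \<in> K" for h c h' c'
  proof -
    obtain t \<mu>1 where 1: "0 \<le> t" "P1 \<mu>1" "\<And>\<Psi>. \<Psi> \<in> Z \<Longrightarrow> h \<Psi> = c - t * (\<Phi> \<mu>1 \<Psi> - D)"
      using hc(1) by (auto simp: K_def)
    obtain t' \<mu>2 where 2: "0 \<le> t'" "P1 \<mu>2" "\<And>\<Psi>. \<Psi> \<in> Z \<Longrightarrow> h' \<Psi> = c' - t' * (\<Phi> \<mu>2 \<Psi> - D)"
      using hc(2) by (auto simp: K_def)
    show ?thesis
    proof (cases "t + t' = 0")
      case True
      then have "t = 0" "t' = 0" using 1(1) 2(1) by auto
      then show ?thesis using 1 2 by (intro K[of 0, OF _ mu]) auto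
    next
      case False
      \<comment> \<open>As \<open>\<Phi>\<close> is affine in the measure, constraints with
        multipliers \<open>t\<close> and \<open>t'\<close> add up to a single one with multiplier
        \<open>t + t'\<close>, taken at the mixture with weight \<open>u\<close>.\<close>
      define u where "u = t / (t + t')"
      have u: "0 \<le> u" "u \<le> 1" "(t + t') * u = t" "(t + t') * (1 - u) = t'"
        using False 1(1) 2(1) by (auto simp: u_def field_simps)
      obtain \<mu>3 where 3: "P1 \<mu>3" "\<And>f. 1-lipschitz_on UNIV f \<Longrightarrow> (\<integral>x. f x \<partial>\<mu>3) = u * (\<integral>x. f x \<partial>\<mu>1) + (1 - u) * (\<integral>x. f x \<partial>\<mu>2)"
        using P1_mixture[OF 1(2) 2(2) u(1,2)] by blast
      have \<Phi>3: "\<Phi> \<mu>3 \<Psi> = u * \<Phi> \<mu>1 \<Psi> + (1 - u) * \<Phi> \<mu>2 \<Psi>" if "\<Psi> \<in> Z" for \<Psi>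
        unfolding \<Phi>_def sum_distrib_left sum.distrib[symmetric]
        using that by (intro sum.cong) (auto simp: 3(2) ZD algebra_simps)
      show ?thesis
      proof (rule K[of "t + t'", OF _ 3(1)])
        fix \<Psi> assume \<Psi>: "\<Psi> \<in> Z"
        have "(t + t') * (\<Phi> \<mu>3 \<Psi> - D) = ((t + t') * u) * \<Phi> \<mu>1 \<Psi> + ((t + t') * (1 - u)) * \<Phi> \<mu>2 \<Psi> - (t + t') * D"
          by (simp add: \<Phi>3[OF \<Psi>] algebra_simps)
        then show "h \<Psi> + h' \<Psi> = c + c' - (t + t') * (\<Phi> \<mu>3 \<Psi> - D)"
          unfolding u(3,4) by (simp add: 1(3)[OF \<Psi>] 2(3)[OF \<Psi>] algebra_simps)
      qed (use 1 2 in simp)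
    qed
  qed
  have scale: "((\<lambda>z. a * h z), a * c) \<in> K" if hc: "(h, c) \<in> K" and a: "a > 0" for h c a
  proof -
    obtain t \<mu>' where 1: "0 \<le> t" "P1 \<mu>'" "\<And>\<Psi>. \<Psi> \<in> Z \<Longrightarrow> h \<Psi> = c - t * (\<Phi> \<mu>' \<Psi> - D)"
      using hc by (auto simp: K_def)
    show ?thesis
      by (rule K[of "a * t", OF _ 1(2)]) (use 1(1) a in \<open>simp_all add: 1(3) right_diff_distrib mult.assoc\<close>)
  qed
  have consistent: "0 \<le> c" if hc: "(h, c) \<in> K" and h: "\<And>z. z \<in> Z \<Longrightarrow> 0 \<le> h z" for h c
  proof (rule ccontr)
    assume "\<not> 0 \<le> c"
    obtain t \<mu>' where 1: "0 \<le> t" "P1 \<mu>'" "\<And>\<Psi>. \<Psi> \<in> Z \<Longrightarrow> h \<Psi> = c - t * (\<Phi> \<mu>' \<Psi> - D)"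
      using hc by (auto simp: K_def)
    show False
    proof (cases "t = 0")
      case True
      then show ?thesis using 1(3)[OF Z0] h[OF Z0] \<open>\<not> 0 \<le> c\<close> by simp
    next
      case False
      then have t: "t > 0" using 1(1) by simp
      \<comment> \<open>For negative \<open>c\<close> the slack \<open>- c / t\<close> in
        \<open>sup_ge\<close> is positive and produces a tuple at which \<open>h\<close> is
        negative.\<close>
      then obtain \<Psi> where \<Psi>: "\<Psi> \<in> Z" "D - (- c / t) < \<Phi> \<mu>' \<Psi>"
        using sup_ge[OF 1(2), of "- c / t"] \<open>\<not> 0 \<le> c\<close> by (auto simp: field_simps)
      then have "c < t * (\<Phi> \<mu>' \<Psi> - D)" using t by (simp add: field_simps)
      then show ?thesis using h[OF \<Psi>(1)] 1(3)[OF \<Psi>(1)] by simp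
    qed
  qed
  define V where "V = {f. \<exists>(h, r)\<in>K. \<forall>z\<in>Z. \<bar>f z\<bar> \<le> h z}"
  note ex = monotone_functional_exists[OF zero add scale consistent V_def]
  have V: "fun_subspace V" by (rule conjunct1[OF ex])
  from conjunct2[OF ex] obtain L where LL: "linear_functional_on V L \<and>
      (\<forall>f\<in>V. \<forall>g\<in>V. (\<forall>z\<in>Z. f z \<le> g z) \<longrightarrow> L f \<le> L g) \<and>
      (\<forall>h r. (h, r) \<in> K \<longrightarrow> (\<forall>f\<in>V. (\<forall>z\<in>Z. f z \<le> h z) \<longrightarrow> L f \<le> r))" ..
  note L = conjunct1[OF LL]
  note mono = conjunct1[OF conjunct2[OF LL], rule_format]
  note LK = conjunct2[OF conjunct2[OF LL], rule_format]
  note sp = fun_subspaceD[OF V] and Ladd = linear_functional_onD(1)[OF L]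
    and diff = linear_functional_on_diff[OF V L]
  have constK: "((\<lambda>_. c), c) \<in> K" for c by (rule K[of 0, OF _ mu]) simp_all
  have memV: "f \<in> V" if "\<And>\<Psi>. \<Psi> \<in> Z \<Longrightarrow> \<bar>f \<Psi>\<bar> \<le> c" for f c
  proof -
    have "\<exists>(h, r)\<in>K. \<forall>z\<in>Z. \<bar>f z\<bar> \<le> h z"
      by (rule bexI[OF _ constK[of c]]) (simp add: that)
    then show ?thesis by (simp add: V_def)
  qed
  have constV: "(\<lambda>_. c) \<in> V" for c by (rule memV[of _ "\<bar>c\<bar>"]) simp
  have Lconst: "L (\<lambda>_. c) = c" for c
  proof (rule antisym)
    show "L (\<lambda>_. c) \<le> c" by (rule LK[OF constK constV]) simp
    have "L (\<lambda>_. - c) \<le> - c" by (rule LK[OF constK constV]) simp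
    then show "c \<le> L (\<lambda>_. c)" using linear_functional_on_minus[OF L constV, of c] by simp
  qed
  have evV: "(\<lambda>\<Psi>. \<Psi> i x) \<in> V" if "i < N" for i x
  proof (rule memV)
    fix \<Psi> assume "\<Psi> \<in> Z"
    then show "\<bar>\<Psi> i x\<bar> \<le> dist x x0"
      using lipschitz_1_abs_le[OF ZD(1)[OF _ that], of \<Psi> x x0] ZD(2)[OF _ that, of \<Psi>] by simp
  qed
  define \<psi> where "\<psi> i x = L (\<lambda>\<Psi>. \<Psi> i x)" for i x
  have lip: "1-lipschitz_on UNIV (\<psi> i)" if i: "i < N" for i
  proof (rule lipschitz_1I)
    fix x y
    have "L (\<lambda>\<Psi>. \<Psi> i x) \<le> L (\<lambda>\<Psi>. \<Psi> i y + dist x y)"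
    proof (rule mono[OF evV[OF i] sp(2)[OF evV[OF i] constV]])
      fix \<Psi> assume "\<Psi> \<in> Z"
      then show "\<Psi> i x \<le> \<Psi> i y + dist x y"
        using lipschitz_1_abs_le[OF ZD(1)[OF _ i], of \<Psi> x y] by (simp add: abs_le_iff)
    qed
    also have "\<dots> = \<psi> i y + dist x y"
      using Ladd[OF evV[OF i] constV] by (simp add: \<psi>_def Lconst)
    finally show "\<psi> i x - \<psi> i y \<le> dist x y" by (simp add: \<psi>_def)
  qed
  have IV: "(\<lambda>\<Psi>. \<integral>x. \<Psi> i x \<partial>M) \<in> V" if "i < N" "P1 M" for i M
  proof (rule memV)
    fix \<Psi> assume "\<Psi> \<in> Z"
    then show "\<bar>\<integral>x. \<Psi> i x \<partial>M\<bar> \<le> (\<integral>x. dist x0 x \<partial>M)"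
      using integral_lipschitz_P1_le[OF that(2) ZD(1)[OF _ that(1)], of \<Psi> x0] ZD(2)[OF _ that(1), of \<Psi>] by simp
  qed
  have bary: "L (\<lambda>\<Psi>. \<integral>x. \<Psi> i x \<partial>M) = (\<integral>x. \<psi> i x \<partial>M)" if i: "i < N" and M: "P1 M" for i M
  proof -
    \<comment> \<open>The mean \<open>L\<close> is only finitely additive, so it is exchanged with
      the integral through finite sums, whose approximation error is uniform over
      \<open>Z\<close>.\<close>
    define S where "S n \<Psi> = (\<Sum>a\<le>n. measure M {x. nearest s n x = a} * \<Psi> i (s a))" for n and \<Psi> :: "nat \<Rightarrow> 'a \<Rightarrow> real"
    have S: "S n \<in> V" "L (S n) = (\<Sum>a\<le>n. measure M {x. nearest s n x = a} * \<psi> i (s a))" for n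
      using linear_functional_on_sum[OF V L, of "{..n}" "\<lambda>a \<Psi>. \<Psi> i (s a)" "\<lambda>a. measure M {x. nearest s n x = a}"] evV[OF i]
      unfolding S_def[abs_def] \<psi>_def by simp_all
    have "\<bar>L (\<lambda>\<Psi>. \<integral>x. \<Psi> i x \<partial>M) - (\<integral>x. \<psi> i x \<partial>M)\<bar> \<le> 0 + e" if e: "e > 0" for e
    proof -
      obtain n where n: "(\<integral>x. dist x (s (nearest s n x)) \<partial>M) < e / 2"
        using quantization_error_small[of s M "e/2", OF dense M] e by auto
      have SI: "(\<integral>x. \<Psi> i x \<partial>M) \<le> S n \<Psi> + e / 2" "S n \<Psi> \<le> (\<integral>x. \<Psi> i x \<partial>M) + e / 2" if "\<Psi> \<in> Z" for \<Psi>
        using integral_cell_approx[OF M ZD(1)[OF that i], of s n] n unfolding S_def by linarith+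
      have "L (\<lambda>\<Psi>. \<integral>x. \<Psi> i x \<partial>M) \<le> L (\<lambda>\<Psi>. S n \<Psi> + e / 2)"
        by (rule mono[OF IV[OF i M] sp(2)[OF S(1) constV]]) (rule SI(1))
      moreover have "L (S n) \<le> L (\<lambda>\<Psi>. (\<integral>x. \<Psi> i x \<partial>M) + e / 2)"
        by (rule mono[OF S(1) sp(2)[OF IV[OF i M] constV]]) (rule SI(2))
      ultimately have "\<bar>L (\<lambda>\<Psi>. \<integral>x. \<Psi> i x \<partial>M) - L (S n)\<bar> \<le> e / 2"
        using Ladd[OF S(1)[of n] constV, of "e/2"] Ladd[OF IV[OF i M] constV, of "e/2"] unfolding Lconst by linarith
      moreover have "\<bar>(\<integral>x. \<psi> i x \<partial>M) - L (S n)\<bar> \<le> e / 2"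
        using integral_cell_approx[OF M lip[OF i], of s n] n unfolding S(2) by linarith
      ultimately show ?thesis by linarith
    qed
    then have "\<bar>L (\<lambda>\<Psi>. \<integral>x. \<Psi> i x \<partial>M) - (\<integral>x. \<psi> i x \<partial>M)\<bar> \<le> 0" by (rule field_le_epsilon)
    then show ?thesis by simp
  qed
  show ?thesis
  proof (intro exI[of _ \<psi>] conjI allI impI lip)
    fix \<mu>' :: "'a measure" assume mu': "P1 \<mu>'"
    have \<Phi>: "\<Phi> \<mu>' \<in> V" "L (\<Phi> \<mu>') = (\<Sum>i<N. lam i * ((\<integral>x. \<psi> i x \<partial>nu i) - (\<integral>x. \<psi> i x \<partial>\<mu>')))"
    proof -
      have i: "(\<lambda>\<Psi>. (\<integral>x. \<Psi> i x \<partial>nu i) - (\<integral>x. \<Psi> i x \<partial>\<mu>')) \<in> V"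
          "L (\<lambda>\<Psi>. (\<integral>x. \<Psi> i x \<partial>nu i) - (\<integral>x. \<Psi> i x \<partial>\<mu>')) = (\<integral>x. \<psi> i x \<partial>nu i) - (\<integral>x. \<psi> i x \<partial>\<mu>')" if "i < N" for i
        using diff[OF IV[OF that nu[OF that]] IV[OF that mu']] bary[OF that] nu[OF that] mu' by simp_all
      show "\<Phi> \<mu>' \<in> V" "L (\<Phi> \<mu>') = (\<Sum>i<N. lam i * ((\<integral>x. \<psi> i x \<partial>nu i) - (\<integral>x. \<psi> i x \<partial>\<mu>')))"
        using linear_functional_on_sum[OF V L, of "{..<N}" "\<lambda>i \<Psi>. (\<integral>x. \<Psi> i x \<partial>nu i) - (\<integral>x. \<Psi> i x \<partial>\<mu>')" lam] i
        unfolding \<Phi>_def[abs_def] by simp_all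
    qed
    \<comment> \<open>This is the constraint with \<open>c = 0\<close> and \<open>t = 1\<close> at
      the given competitor.\<close>
    have "L (\<lambda>\<Psi>. D - \<Phi> \<mu>' \<Psi>) \<le> 0"
      by (rule LK[OF K[of 1, OF _ mu'] diff(1)[OF constV \<Phi>(1)]]) auto
    then have "D \<le> L (\<Phi> \<mu>')" using diff(2)[OF constV \<Phi>(1), of D] by (simp add: Lconst)
    then show "(\<Sum>i<N. lam i * W1 (nu i) \<mu>) \<le> (\<Sum>i<N. lam i * ((\<integral>x. \<psi> i x \<partial>nu i) - (\<integral>x. \<psi> i x \<partial>\<mu>')))"
      by (simp add: \<Phi>(2) D_def)
  qed
qed

text \<open>Tested at \<mu>, the saddle inequality forces every duality gap to vanish, as the gaps
  are nonnegative and the weights positive. Tested at a Dirac mass, it bounds the weighted sum of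
  potentials pointwise by its \<mu>-mean \<open>c\<close>.\<close>

lemma Med_potentials:
  fixes nu :: "nat \<Rightarrow> 'a::metric_space measure" and s :: "nat \<Rightarrow> 'a"
  assumes dense: "\<And>x e. e > 0 \<Longrightarrow> \<exists>n. dist x (s n) < e"
    and nu: "\<And>i. i < N \<Longrightarrow> P1 (nu i)" and lam: "\<And>i. i < N \<Longrightarrow> lam i > 0"
    and lam_sum: "(\<Sum>i<N. lam i) = 1" and med: "\<mu> \<in> Med N lam nu"
  shows "\<exists>\<psi>. (\<forall>i<N. 1-lipschitz_on UNIV (\<psi> i) \<and>
              W1 (nu i) \<mu> = (\<integral>x. \<psi> i x \<partial>nu i) - (\<integral>x. \<psi> i x \<partial>\<mu>)) \<and>
       (\<forall>x. (\<Sum>i<N. lam i * \<psi> i x) \<le> 0) \<and>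
       (\<forall>x\<in>spt \<mu>. (\<Sum>i<N. lam i * \<psi> i x) = 0)"
proof -
  have mu: "P1 \<mu>" using med by (simp add: Med_def)
  have "\<exists>\<psi>. (\<forall>i<N. 1-lipschitz_on UNIV (\<psi> i)) \<and> (\<forall>\<mu>'. P1 \<mu>' \<longrightarrow>
    (\<Sum>i<N. lam i * W1 (nu i) \<mu>) \<le> (\<Sum>i<N. lam i * ((\<integral>x. \<psi> i x \<partial>nu i) - (\<integral>x. \<psi> i x \<partial>\<mu>'))))"
    by (rule Med_potentials_saddle[OF dense nu lam lam_sum med])
  then obtain \<psi> where lip: "\<And>i. i < N \<Longrightarrow> 1-lipschitz_on UNIV (\<psi> i)"
    and saddle: "\<And>\<mu>'. P1 \<mu>' \<Longrightarrow> (\<Sum>i<N. lam i * W1 (nu i) \<mu>) \<le> (\<Sum>i<N. lam i * ((\<integral>x. \<psi> i x \<partial>nu i) - (\<integral>x. \<psi> i x \<partial>\<mu>')))"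
    by blast
  have zero: "\<forall>i\<in>{..<N}. lam i * (W1 (nu i) \<mu> - ((\<integral>x. \<psi> i x \<partial>nu i) - (\<integral>x. \<psi> i x \<partial>\<mu>))) = 0"
  proof (rule ccontr)
    have nonneg: "0 \<le> lam i * (W1 (nu i) \<mu> - ((\<integral>x. \<psi> i x \<partial>nu i) - (\<integral>x. \<psi> i x \<partial>\<mu>)))" if "i \<in> {..<N}" for i
      using that Kantorovich_Rubinstein_ge[OF dense nu mu lip, of i] lam[of i] by simp
    assume "\<not> ?thesis"
    then have "(\<Sum>i<N. lam i * (W1 (nu i) \<mu> - ((\<integral>x. \<psi> i x \<partial>nu i) - (\<integral>x. \<psi> i x \<partial>\<mu>)))) \<noteq> 0"
      using sum_nonneg_eq_0_iff[OF finite_lessThan nonneg] by simp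
    moreover have "0 \<le> (\<Sum>i<N. lam i * (W1 (nu i) \<mu> - ((\<integral>x. \<psi> i x \<partial>nu i) - (\<integral>x. \<psi> i x \<partial>\<mu>))))"
      by (rule sum_nonneg) (rule nonneg)
    ultimately show False using saddle[OF mu]
      by (simp only: right_diff_distrib[of _ "W1 _ _"] sum_subtractf)
  qed
  have opt: "W1 (nu i) \<mu> = (\<integral>x. \<psi> i x \<partial>nu i) - (\<integral>x. \<psi> i x \<partial>\<mu>)" if "i < N" for i
    using bspec[OF zero, of i] that lam[OF that] by simp
  define c where "c = (\<Sum>i<N. lam i * (\<integral>x. \<psi> i x \<partial>\<mu>))"
  have below: "(\<Sum>i<N. lam i * \<psi> i y) \<le> c" for y
  proof -
    have "(\<Sum>i<N. lam i * W1 (nu i) \<mu>) = (\<Sum>i<N. lam i * ((\<integral>x. \<psi> i x \<partial>nu i) - (\<integral>x. \<psi> i x \<partial>\<mu>)))"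
      by (intro sum.cong) (auto simp: opt)
    moreover have "(\<Sum>i<N. lam i * ((\<integral>x. \<psi> i x \<partial>nu i) - (\<integral>x. \<psi> i x \<partial>return borel y)))
        = (\<Sum>i<N. lam i * ((\<integral>x. \<psi> i x \<partial>nu i) - \<psi> i y))"
      using lip by (intro sum.cong) (auto simp: integral_return lipschitz_borel_measurable)
    ultimately show ?thesis
      using saddle[OF P1_return[of y]] by (simp add: c_def right_diff_distrib sum_subtractf)
  qed
  \<comment> \<open>Since the weights sum to 1, shifting every potential by the same
    \<open>c\<close> lowers the weighted sum by \<open>c\<close>: it becomes nonpositive with mean
    0, and the optimality identities persist.\<close>
  define \<phi> where "\<phi> i x = \<psi> i x - c" for i x
  have lip': "1-lipschitz_on UNIV (\<phi> i)" if "i < N" for i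
    using lipschitz_1_abs_le[OF lip[OF that]] by (intro lipschitz_1I) (simp add: \<phi>_def abs_le_iff)
  have int: "(\<integral>x. \<phi> i x \<partial>M) = (\<integral>x. \<psi> i x \<partial>M) - c" if "i < N" "P1 M" for i M
    using integrable_lipschitz_P1[OF that(2) lip[OF that(1)]] prob_space.prob_space[OF P1D(1)[OF that(2)]]
      prob_space.finite_measure[OF P1D(1)[OF that(2)]]
    by (simp add: \<phi>_def finite_measure.integrable_const)
  have sum\<phi>: "(\<Sum>i<N. lam i * \<phi> i x) = (\<Sum>i<N. lam i * \<psi> i x) - c" for x
    using lam_sum by (simp add: \<phi>_def right_diff_distrib sum_subtractf sum_distrib_right[symmetric])
  have "(\<Sum>i<N. lam i * \<phi> i x) = 0" if x: "x \<in> spt \<mu>" for x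
  proof (rule nonpos_integral_eq_0_imp_zero_on_spt[OF mu integral_sum_lipschitz(1)[OF mu lip'] _ _ _ x])
    show "continuous_on UNIV (\<lambda>x. \<Sum>i<N. lam i * \<phi> i x)"
      using lipschitz_on_continuous_on[OF lip'] by (intro continuous_intros) auto
    show "(\<Sum>i<N. lam i * \<phi> i x) \<le> 0" for x using below[of x] sum\<phi>[of x] by simp
    have "(\<integral>x. (\<Sum>i<N. lam i * \<phi> i x) \<partial>\<mu>) = (\<Sum>i<N. lam i * (\<integral>x. \<phi> i x \<partial>\<mu>))"
      by (rule integral_sum_lipschitz(2)[OF mu lip'])
    also have "\<dots> = (\<Sum>i<N. lam i * ((\<integral>x. \<psi> i x \<partial>\<mu>) - c))"
      by (intro sum.cong) (auto simp: int mu)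
    also have "\<dots> = 0"
      using lam_sum by (simp add: c_def[symmetric] right_diff_distrib sum_subtractf sum_distrib_right[symmetric])
    finally show "(\<integral>x. (\<Sum>i<N. lam i * \<phi> i x) \<partial>\<mu>) = 0" .
  qed
  then show ?thesis
    using lip' below sum\<phi> opt int nu mu by (intro exI[of _ \<phi>]) simp
qed

theorem theorem5p5:
  fixes nu :: "nat \<Rightarrow> 'a::metric_space measure" and lam :: "nat \<Rightarrow> real"
    and N :: nat and \<mu> :: "'a measure"
  assumes proper: "proper_space TYPE('a)"
    and nu: "\<forall>i<N. P1 (nu i)"
    and lam_pos: "\<forall>i<N. lam i > 0"
    and lam_sum: "(\<Sum>i<N. lam i) = 1"
    and mu: "P1 \<mu>"
  shows "\<mu> \<in> Med N lam nu \<longleftrightarrow>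
    (\<exists>\<psi> :: nat \<Rightarrow> 'a \<Rightarrow> real.
       (\<forall>i<N. 1-lipschitz_on UNIV (\<psi> i) \<and>
              W1 (nu i) \<mu> = (\<integral>x. \<psi> i x \<partial>nu i) - (\<integral>x. \<psi> i x \<partial>\<mu>)) \<and>
       (\<forall>x. (\<Sum>i<N. lam i * \<psi> i x) \<le> 0) \<and>
       (\<forall>x\<in>spt \<mu>. (\<Sum>i<N. lam i * \<psi> i x) = 0))"
proof -
  obtain s :: "nat \<Rightarrow> 'a" where dense: "\<And>x e. e > 0 \<Longrightarrow> \<exists>n. dist x (s n) < e"
    using proper_space_dense_sequence[OF proper] by blast
  show ?thesis
  proof
    assume med: "\<mu> \<in> Med N lam nu"
    show "\<exists>\<psi>. (\<forall>i<N. 1-lipschitz_on UNIV (\<psi> i) \<and>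
              W1 (nu i) \<mu> = (\<integral>x. \<psi> i x \<partial>nu i) - (\<integral>x. \<psi> i x \<partial>\<mu>)) \<and>
       (\<forall>x. (\<Sum>i<N. lam i * \<psi> i x) \<le> 0) \<and>
       (\<forall>x\<in>spt \<mu>. (\<Sum>i<N. lam i * \<psi> i x) = 0)"
      by (rule Med_potentials[OF dense _ _ lam_sum med]) (use nu lam_pos in auto)
  next
    assume "\<exists>\<psi>. (\<forall>i<N. 1-lipschitz_on UNIV (\<psi> i) \<and>
              W1 (nu i) \<mu> = (\<integral>x. \<psi> i x \<partial>nu i) - (\<integral>x. \<psi> i x \<partial>\<mu>)) \<and>
       (\<forall>x. (\<Sum>i<N. lam i * \<psi> i x) \<le> 0) \<and>
       (\<forall>x\<in>spt \<mu>. (\<Sum>i<N. lam i * \<psi> i x) = 0)"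
    then obtain \<psi> where "\<And>i. i < N \<Longrightarrow> 1-lipschitz_on UNIV (\<psi> i)"
      "\<And>i. i < N \<Longrightarrow> W1 (nu i) \<mu> = (\<integral>x. \<psi> i x \<partial>nu i) - (\<integral>x. \<psi> i x \<partial>\<mu>)"
      "\<And>x. (\<Sum>i<N. lam i * \<psi> i x) \<le> 0" "\<And>x. x \<in> spt \<mu> \<Longrightarrow> (\<Sum>i<N. lam i * \<psi> i x) = 0"
      by blast
    then show "\<mu> \<in> Med N lam nu"
      using nu lam_pos mu by (intro Med_if_potentials[OF dense]) auto
  qed
qed

end
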